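(* Let $N\ge3$, $\bar\mu:=\left(\frac{N-2}{2}\right)^2$, $\mu\in(0,\bar\mu)$, $\nu:=\sqrt{\bar\mu}-\sqrt{\bar\mu-\mu}$, $p\ge 2^*-1$ with $2^*=\frac{2N}{N-2}$, and $q>\max\left\{p,\frac{2+\nu}{\nu}\right\}$. Let $\Omega\subseteq\mathbb{R}^N$ be a smooth domain (bounded or unbounded) with $0\in\Omega$. Then for any solution $u$ of $$-\Delta u-\mu\frac{u}{|x|^2}=u^p-u^q\ \text{ in }\Omega,\qquad u>0\ \text{ in }\Omega,\qquad u\in H_0^1(\Omega)\cap L^{q+1}(\Omega),$$ there exist $C>0$ and a sufficiently small $\rho>0$ such that $$u(x)\le C|x|^{-\frac{2}{q-1}}\qquad\forall\,x\in B_\rho(0)\setminus\{0\}.$$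
   Context: $B_r(0)$ is the open ball of radius $r$ centred at $0$. Solutions are understood in the weak sense. *)

theory Defs
  imports "HOL-Analysis.Analysis"
begin

text \<open>Real-valued functions on an open set \<open>\<Omega>\<close> are represented by total functions whose values
  outside \<open>\<Omega>\<close> play no role.\<close>

primrec C_k :: "nat \<Rightarrow> ('a::euclidean_space \<Rightarrow> real) \<Rightarrow> bool" where
  "C_k 0 f \<longleftrightarrow> continuous_on UNIV f"
| "C_k (Suc k) f \<longleftrightarrow>
     (\<forall>x. f differentiable (at x)) \<and>
     (\<forall>b\<in>Basis. C_k k (\<lambda>x. frechet_derivative f (at x) b))"

definition smooth_fun :: "('a::euclidean_space \<Rightarrow> real) \<Rightarrow> bool" where
  "smooth_fun f \<longleftrightarrow> (\<forall>k. C_k k f)"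

definition grad :: "('a::euclidean_space \<Rightarrow> real) \<Rightarrow> 'a \<Rightarrow> 'a" where
  "grad f x = (\<Sum>b\<in>Basis. frechet_derivative f (at x) b *\<^sub>R b)"

definition test_functions :: "'a::euclidean_space set \<Rightarrow> ('a \<Rightarrow> real) set" where
  "test_functions \<Omega> =
     {\<phi>. smooth_fun \<phi> \<and> compact (closure {x. \<phi> x \<noteq> 0}) \<and> closure {x. \<phi> x \<noteq> 0} \<subseteq> \<Omega>}"

text \<open>Near each boundary point, \<open>\<Omega>\<close> is the region on one side of the graph of a smooth function
  over the hyperplane orthogonal to some unit vector \<open>e\<close>; only the values of \<open>\<gamma>\<close> on that
  hyperplane matter. Unbounded domains, including the whole space, are allowed.\<close>

definition smooth_domain :: "'a::euclidean_space set \<Rightarrow> bool" where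
  "smooth_domain \<Omega> \<longleftrightarrow>
     open \<Omega> \<and> connected \<Omega> \<and> \<Omega> \<noteq> {} \<and>
     (\<forall>z\<in>frontier \<Omega>. \<exists>r>0. \<exists>e \<gamma>. norm e = 1 \<and> smooth_fun \<gamma> \<and>
        \<Omega> \<inter> ball z r = {x \<in> ball z r. \<gamma> (x - (x \<bullet> e) *\<^sub>R e) < x \<bullet> e})"

definition Lebesgue_space ::
  "real \<Rightarrow> 'a::euclidean_space set \<Rightarrow> ('a \<Rightarrow> 'b::euclidean_space) set" where
  "Lebesgue_space r \<Omega> =
     {f. set_borel_measurable lebesgue \<Omega> f \<and>
         set_integrable lebesgue \<Omega> (\<lambda>x. norm (f x) powr r)}"

definition loc_integrable_on ::
  "('a::euclidean_space \<Rightarrow> 'b::euclidean_space) \<Rightarrow> 'a set \<Rightarrow> bool" where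
  "loc_integrable_on f \<Omega> \<longleftrightarrow>
     (\<forall>K. compact K \<and> K \<subseteq> \<Omega> \<longrightarrow> set_integrable lebesgue K f)"

definition has_weak_gradient ::
  "'a::euclidean_space set \<Rightarrow> ('a \<Rightarrow> real) \<Rightarrow> ('a \<Rightarrow> 'a) \<Rightarrow> bool" where
  "has_weak_gradient \<Omega> u G \<longleftrightarrow>
     loc_integrable_on u \<Omega> \<and> loc_integrable_on G \<Omega> \<and>
     (\<forall>\<phi>\<in>test_functions \<Omega>. \<forall>b\<in>Basis.
        (LINT x:\<Omega>|lebesgue. u x * (grad \<phi> x \<bullet> b)) = - (LINT x:\<Omega>|lebesgue. (G x \<bullet> b) * \<phi> x))"

definition H1 :: "'a::euclidean_space set \<Rightarrow> ('a \<Rightarrow> real) set" where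
  "H1 \<Omega> = {u \<in> Lebesgue_space 2 \<Omega>. \<exists>G. has_weak_gradient \<Omega> u G \<and> G \<in> Lebesgue_space 2 \<Omega>}"

text \<open>The closure of the test functions in the norm of \<open>H1\<close>. Weak gradients are unique up to null
  sets, so the choice of \<open>G\<close> is immaterial.\<close>

definition H1_0 :: "'a::euclidean_space set \<Rightarrow> ('a \<Rightarrow> real) set" where
  "H1_0 \<Omega> = {u \<in> H1 \<Omega>. \<exists>G. has_weak_gradient \<Omega> u G \<and>
     (\<exists>\<phi>. (\<forall>k::nat. \<phi> k \<in> test_functions \<Omega>) \<and>
        (\<lambda>k. (LINT x:\<Omega>|lebesgue. (\<phi> k x - u x)\<^sup>2 + (norm (grad (\<phi> k) x - G x))\<^sup>2))
          \<longlonglongrightarrow> 0)}"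

text \<open>Weak form of \<open>- \<Delta>u - \<mu> u / |x|^2 = u^p - u^q\<close> in \<open>\<Omega>\<close>. For positive
  \<open>u\<close> in \<open>H1_0 \<Omega>\<close> and in the Lebesgue space of exponent \<open>q + 1\<close>, in dimension at least three
  and with \<open>1 < p < q\<close>, all the integrals below converge absolutely.\<close>

definition weak_solution ::
  "'a::euclidean_space set \<Rightarrow> real \<Rightarrow> real \<Rightarrow> real \<Rightarrow> ('a \<Rightarrow> real) \<Rightarrow> bool" where
  "weak_solution \<Omega> \<mu> p q u \<longleftrightarrow>
     (\<exists>G. has_weak_gradient \<Omega> u G \<and>
       (\<forall>\<phi>\<in>test_functions \<Omega>.
          (LINT x:\<Omega>|lebesgue. G x \<bullet> grad \<phi> x)
            - \<mu> * (LINT x:\<Omega>|lebesgue. u x / (norm x)\<^sup>2 * \<phi> x)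
          = (LINT x:\<Omega>|lebesgue. (u x powr p - u x powr q) * \<phi> x)))"

end

(* A Keller-Osserman argument with a single test function. Fix z near 0 and R = |z| / 2, so that
   |x| is at least R on the ball of radius R about z. Test the equation with
   phi(x) = chi(tau) tau^(1 - N/2), where tau = |x - z|^2 / R^2 + e: a smooth cutoff times the
   regularised fundamental solution. Its Laplacian is an error term minus a nonnegative kernel
   concentrated on |x - z| of order R sqrt(e). Because the cutoff is infinitely flat at its edge,
   the q-th power of the error is at most a constant times phi, uniformly in e. Young's inequality
   therefore absorbs the error, the Hardy term and u^p into u^q phi, at the cost of a constant
   times R^(-2q/(q-1)) (1 + phi). What remains bounds the averages of u over all small balls about
   z by a constant times R^(-2/(q-1)), and the pointwise bound follows by Lebesgue
   differentiation. *)
theory Submission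
  imports Defs "HOL-Real_Asymp.Real_Asymp"
begin

section \<open>Calculus of smooth functions\<close>

text \<open>A plain cutoff at scale R would control the average of u only over balls of radius
  comparable to R. The pole is what reaches every smaller radius r with the same constant: for e =
  (r / R)^2 the kernel is at least a constant times (r / R)^(-N) on the ball of radius r about z,
  while the integral of phi over the ball of radius R stays of order R^N uniformly in e, since
  |y|^(2 - N) is locally integrable. The quotient of the two is r^N. The regularisation by e keeps
  phi an admissible smooth test function. The power of R comes from scaling alone. Second
  derivatives of phi and the weight |x|^(-2) both have size R^(-2), so the Hardy term, despite its
  bad sign, is treated like the cutoff error. Young's inequality with exponent q turns R^(-2) into
  R^(-2q/(q-1)); the kernel side carries its own factor R^(-2), and dividing by it leaves
  R^(-2/(q-1)). The constants must be fixed before z, R, e and r are chosen, which is why the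
  estimates are stated with leading existential quantifiers.\<close>

lemma C_k_SucI:
  assumes "\<And>x. (f has_derivative f' x) (at x)" "\<And>b. b \<in> Basis \<Longrightarrow> C_k k (\<lambda>x. f' x b)"
  shows "C_k (Suc k) f"
proof -
  have "frechet_derivative f (at x) = f' x" for x
    using frechet_derivative_at[OF assms(1)] by simp
  then show ?thesis
    using assms by (auto simp: differentiable_def)
qed

lemma C_k_Suc_has_derivative:
  assumes "C_k (Suc k) f"
  shows "(f has_derivative frechet_derivative f (at x)) (at x)"
  using assms by (simp add: frechet_derivative_works)

lemma C_k_mono: "C_k (Suc k) f \<Longrightarrow> C_k k f"
proof (induction k arbitrary: f)
  case 0
  then show ?case
    by (auto simp: continuous_on_eq_continuous_at intro: differentiable_imp_continuous_within)
next
  case (Suc k)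
  then show ?case
    by (metis C_k.simps(2))
qed

lemma C_k_const: "C_k k (\<lambda>_. c)"
proof (induction k arbitrary: c)
  case (Suc k)
  then show ?case
    by (intro C_k_SucI[where f' = "\<lambda>_ _. 0"]) auto
qed simp

lemma C_k_add: "C_k k f \<Longrightarrow> C_k k g \<Longrightarrow> C_k k (\<lambda>x. f x + g x)"
proof (induction k arbitrary: f g)
  case (Suc k)
  show ?case
    by (rule C_k_SucI[OF has_derivative_add[OF Suc.prems[THEN C_k_Suc_has_derivative]]])
       (use Suc in auto)
qed (auto intro: continuous_intros)

lemma C_k_mult: "C_k k f \<Longrightarrow> C_k k g \<Longrightarrow> C_k k (\<lambda>x. f x * g x)"
proof (induction k arbitrary: f g)
  case (Suc k)
  show ?case
    by (rule C_k_SucI[OF has_derivative_mult[OF Suc.prems[THEN C_k_Suc_has_derivative]]])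
       (use Suc.prems Suc.prems[THEN C_k_mono] in \<open>auto intro!: C_k_add Suc.IH\<close>)
qed (auto intro: continuous_intros)

lemma C_k_bounded_linear:
  assumes "bounded_linear f"
  shows "C_k k f"
proof (cases k)
  case 0
  then show ?thesis
    using assms by (auto intro: linear_continuous_on)
next
  case (Suc j)
  then show ?thesis
    unfolding Suc
    by (intro C_k_SucI[where f' = "\<lambda>_. f"] bounded_linear_imp_has_derivative assms C_k_const)
qed

text \<open>Carrying the whole chain \<open>F\<close> of successive derivatives through the
  induction, with \<open>n\<close> arbitrary, keeps the claim closed under the chain rule and avoids
  a formula for higher derivatives of a composition. The set \<open>S\<close> accommodates real
  powers, which are differentiated on the positive axis only.\<close>

lemma C_k_compose:
  assumes F: "\<And>n t. t \<in> S \<Longrightarrow> (F n has_real_derivative F (Suc n) t) (at t)"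
    and gS: "\<And>x. g x \<in> S"
  shows "C_k k g \<Longrightarrow> C_k k (\<lambda>x. F n (g x))"
proof (induction k arbitrary: n)
  case 0
  have "isCont (\<lambda>x. F n (g x)) x" for x
    using 0 DERIV_isCont[OF F[OF gS]]
    by (intro isCont_o2[where g = "F n" and f = g]) (simp_all add: continuous_on_eq_continuous_at)
  then show ?case
    by (auto intro: continuous_at_imp_continuous_on)
next
  case (Suc k)
  show ?case
  proof (rule C_k_SucI)
    fix x
    show "((\<lambda>x. F n (g x)) has_derivative (\<lambda>h. F (Suc n) (g x) * frechet_derivative g (at x) h)) (at x)"
      using has_derivative_compose[OF C_k_Suc_has_derivative[OF Suc.prems(1)], where g = "F n"] F[OF gS]
      unfolding has_field_derivative_def by blast
  next
    fix b :: 'a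
    assume "b \<in> Basis"
    then show "C_k k (\<lambda>x. F (Suc n) (g x) * frechet_derivative g (at x) b)"
      using Suc.prems C_k_mono[OF Suc.prems] by (intro C_k_mult Suc.IH) simp_all
  qed
qed

lemma smooth_fun_mult: "smooth_fun f \<Longrightarrow> smooth_fun g \<Longrightarrow> smooth_fun (\<lambda>x. f x * g x)"
  by (simp add: smooth_fun_def C_k_mult)

lemma smooth_fun_powr:
  assumes "smooth_fun g" "\<And>x. g x > 0"
  shows "smooth_fun (\<lambda>x. g x powr a)"
proof -
  define F where "F = (\<lambda>n t. (\<Prod>i<n. a - real i) * t powr (a - real n))"
  have "(F n has_real_derivative F (Suc n) t) (at t)" if "t \<in> {0<..}" for n t
    using that unfolding F_def
    by (auto intro!: derivative_eq_intros simp: algebra_simps)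
  from C_k_compose[where F = F and n = 0 and S = "{0<..}", OF this] have "C_k k (\<lambda>x. F 0 (g x))" for k
    using assms by (auto simp: smooth_fun_def)
  then show ?thesis
    by (simp add: smooth_fun_def F_def)
qed

lemma smooth_fun_partial: "smooth_fun f \<Longrightarrow> b \<in> Basis \<Longrightarrow> smooth_fun (\<lambda>x. frechet_derivative f (at x) b)"
  unfolding smooth_fun_def by (metis C_k.simps(2))

section \<open>A cutoff profile that is flat to infinite order\<close>

definition flat :: "real \<Rightarrow> real" where
  "flat t = (if t > 0 then exp (- 1 / t) else 0)"

text \<open>This class contains \<open>flat\<close> and is closed under differentiation, so
  smoothness of \<open>flat\<close> follows from one derivative computation.\<close>

definition flat_poly :: "real poly \<Rightarrow> real \<Rightarrow> real" where
  "flat_poly P t = poly P (1 / t) * flat t"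

lemma tendsto_poly_exp_uminus:
  fixes P :: "real poly"
  assumes "c > 0"
  shows "((\<lambda>y. poly P y * exp (- (c * y))) \<longlongrightarrow> 0) at_top"
proof -
  have "((\<lambda>y::real. y ^ n * exp (- (c * y))) \<longlongrightarrow> 0) at_top" for n
    using assms by real_asymp
  then have "((\<lambda>y. \<Sum>i\<le>degree P. coeff P i * (y ^ i * exp (- (c * y)))) \<longlongrightarrow> (\<Sum>i\<le>degree P. coeff P i * 0)) at_top"
    by (intro tendsto_intros)
  then show ?thesis
    by (simp add: poly_altdef sum_distrib_right mult.assoc)
qed

text \<open>With y = 1 / t, the derivative of y in t is - y^2 and that of P(y) exp(-y) in y is (P' -
  P)(y) exp(-y); the factor \<open>[:0, 0, 1:]\<close> is y^2.\<close>

lemma flat_poly_deriv: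
  "(flat_poly P has_real_derivative flat_poly ([:0, 0, 1:] * (P - pderiv P)) t) (at t)"
proof -
  consider "t > 0" | "t < 0" | "t = 0" by linarith
  then show ?thesis
  proof cases
    case 1
    have "((\<lambda>t. poly P (1 / t) * exp (- 1 / t)) has_real_derivative
        flat_poly ([:0, 0, 1:] * (P - pderiv P)) t) (at t)"
      using 1 by (auto intro!: derivative_eq_intros DERIV_chain2[OF poly_DERIV] simp: flat_poly_def flat_def field_simps power2_eq_square)
    then show ?thesis
      by (rule has_field_derivative_transform_within_open[of _ _ _ "{0<..}"])
         (use 1 in \<open>auto simp: flat_poly_def flat_def\<close>)
  next
    case 2
    have "((\<lambda>t. 0) has_real_derivative flat_poly ([:0, 0, 1:] * (P - pderiv P)) t) (at t)"
      using 2 by (auto simp: flat_poly_def flat_def)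
    then show ?thesis
      by (rule has_field_derivative_transform_within_open[of _ _ _ "{..<0}"])
         (use 2 in \<open>auto simp: flat_poly_def flat_def\<close>)
  next
    case 3
    \<comment> \<open>For h > 0 and y = 1 / h the difference quotient at 0 is y P(y) exp(-y); the
      factor \<open>[:0, 1:]\<close> accounts for the division by h.\<close>
    have "((\<lambda>y. poly ([:0, 1:] * P) y * exp (- (1 * y))) \<longlongrightarrow> 0) at_top"
      by (rule tendsto_poly_exp_uminus) simp
    then have "((\<lambda>h. poly ([:0, 1:] * P) (inverse h) * exp (- (1 * inverse h))) \<longlongrightarrow> 0) (at_right 0)"
      by (rule filterlim_compose) (rule filterlim_inverse_at_top_right)
    then have "((\<lambda>h. flat_poly P h / h) \<longlongrightarrow> 0) (at_right 0)"
      by (rule Lim_transform_eventually)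
         (auto simp: eventually_at_right_field flat_poly_def flat_def field_simps intro!: exI[of _ 1])
    moreover have "((\<lambda>h. flat_poly P h / h) \<longlongrightarrow> 0) (at_left 0)"
      by (rule Lim_transform_eventually[OF tendsto_const])
         (auto simp: eventually_at_left_field flat_poly_def flat_def intro!: exI[of _ "-1"])
    ultimately have "((\<lambda>h. flat_poly P h / h) \<longlongrightarrow> 0) (at 0)"
      by (simp add: filterlim_split_at)
    then show ?thesis
      using 3 by (simp add: DERIV_def flat_poly_def flat_def)
  qed
qed

lemma flat_eq_flat_poly: "flat = flat_poly [:1:]"
  by (simp add: fun_eq_iff flat_poly_def)

text \<open>The polynomials keep the shape that \<open>flat_poly_deriv\<close> produces. For t > 0,
  \<open>flat1 t\<close> is t^(-2) exp(-1/t) and \<open>flat2 t\<close> is (t^(-4) - 2 t^(-3))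
  exp(-1/t).\<close>

definition flat1 :: "real \<Rightarrow> real" where "flat1 = flat_poly ([:0, 0, 1:] * ([:1:] - pderiv [:1:]))"
definition flat2 :: "real \<Rightarrow> real" where
  "flat2 = flat_poly ([:0, 0, 1:] * ([:0, 0, 1:] * ([:1:] - pderiv [:1:]) - pderiv ([:0, 0, 1:] * ([:1:] - pderiv [:1:]))))"

lemma flat_deriv: "(flat has_real_derivative flat1 t) (at t)"
  unfolding flat_eq_flat_poly flat1_def by (rule flat_poly_deriv)

lemma flat1_deriv: "(flat1 has_real_derivative flat2 t) (at t)"
  unfolding flat1_def flat2_def by (rule flat_poly_deriv)

lemma flat_nonneg: "flat t \<ge> 0" and flat_le_1: "flat t \<le> 1" and flat_nonpos: "t \<le> 0 \<Longrightarrow> flat t = 0"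
  and flat_pos: "t > 0 \<Longrightarrow> flat t > 0"
  by (auto simp: flat_def)

lemma flat_mono: "s \<le> t \<Longrightarrow> flat s \<le> flat t"
  by (auto simp: flat_def divide_simps)

lemma flat12_nonpos: "t \<le> 0 \<Longrightarrow> flat1 t = 0" "t \<le> 0 \<Longrightarrow> flat2 t = 0"
  by (simp_all add: flat1_def flat2_def flat_poly_def flat_nonpos)

lemma smooth_fun_flat:
  assumes "smooth_fun g"
  shows "smooth_fun (\<lambda>x. flat (g x))"
proof -
  define F where "F = (\<lambda>n. flat_poly (((\<lambda>P. [:0, 0, 1:] * (P - pderiv P)) ^^ n) [:1:]))"
  have "(F n has_real_derivative F (Suc n) t) (at t)" for n t
    unfolding F_def by (simp del: mult_pCons_left) (rule flat_poly_deriv)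
  from C_k_compose[where F = F and n = 0 and S = UNIV, OF this] have "C_k k (\<lambda>x. F 0 (g x))" for k
    using assms by (auto simp: smooth_fun_def)
  then show ?thesis
    by (simp add: smooth_fun_def F_def flat_eq_flat_poly)
qed

text \<open>In y = 1 / t the claim is |P(y)|^q exp(-q y) \<le> C exp(-y). After a q-th root it says
  that P(y) exp(-(1 - 1/q) y) is bounded for y > 0, which holds because q > 1. A cutoff vanishing
  like t^k would tie k to q and to the order of the derivative; the exponential serves all of them
  at once.\<close>

lemma flat_poly_powr_le_flat:
  assumes q: "q > 1"
  shows "\<exists>C\<ge>0. \<forall>t>0. \<bar>flat_poly P t\<bar> powr q \<le> C * flat t"
proof -
  define h where "h = (\<lambda>y. poly P y * exp (- ((1 - 1 / q) * y)))"
  have "(h \<longlongrightarrow> 0) at_top"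
    unfolding h_def using q by (intro tendsto_poly_exp_uminus) simp
  then have "eventually (\<lambda>y. dist (h y) 0 < 1) at_top"
    by (rule tendstoD) simp
  then obtain Y where Y: "\<And>y. y \<ge> Y \<Longrightarrow> \<bar>h y\<bar> < 1"
    by (auto simp: eventually_at_top_linorder)
  have "compact (h ` {0..max Y 0})"
    unfolding h_def by (intro compact_continuous_image continuous_intros) auto
  then obtain B where B: "\<And>y. y \<in> {0..max Y 0} \<Longrightarrow> \<bar>h y\<bar> \<le> B"
    by (meson bounded_real compact_imp_bounded imageI)
  have h: "\<bar>h y\<bar> \<le> max 1 B" if "y \<ge> 0" for y
    using Y[of y] B[of y] that by (cases "y \<ge> Y") auto
  have "\<bar>flat_poly P t\<bar> powr q \<le> max 1 B powr q * flat t" if "t > 0" for t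
  proof -
    have eq: "flat_poly P t = h (1 / t) * exp (- (1 / (q * t)))"
    proof -
      have "- (1 / t) = - ((1 - 1 / q) * (1 / t)) + - (1 / (q * t))"
        using that q by (simp add: field_simps)
      then show ?thesis
        using that unfolding flat_poly_def flat_def h_def by (simp flip: exp_add)
    qed
    have "\<bar>flat_poly P t\<bar> powr q = \<bar>h (1 / t)\<bar> powr q * exp (- (1 / (q * t))) powr q"
      by (simp add: eq abs_mult powr_mult)
    also have "exp (- (1 / (q * t))) powr q = flat t"
      using that q by (simp add: powr_def flat_def)
    also have "\<bar>h (1 / t)\<bar> powr q * flat t \<le> max 1 B powr q * flat t"
      using h[of "1 / t"] that q by (intro mult_right_mono powr_mono2) (auto simp: flat_nonneg)
    finally show ?thesis .
  qed
  then show ?thesis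
    by (intro exI[of _ "max 1 B powr q"]) auto
qed

section \<open>A radial test function\<close>

definition pole :: "real \<Rightarrow> real \<Rightarrow> real" where
  "pole m \<tau> = flat (1 - \<tau> powr (m + 1)) * \<tau> powr (- m)"

definition pole1 :: "real \<Rightarrow> real \<Rightarrow> real" where
  "pole1 m \<tau> = - ((m + 1) * flat1 (1 - \<tau> powr (m + 1))) - m * \<tau> powr (- m - 1) * flat (1 - \<tau> powr (m + 1))"

definition pole2 :: "real \<Rightarrow> real \<Rightarrow> real" where
  "pole2 m \<tau> = (m + 1)\<^sup>2 * \<tau> powr m * flat2 (1 - \<tau> powr (m + 1))
     + m * (m + 1) / \<tau> * flat1 (1 - \<tau> powr (m + 1))
     + m * (m + 1) * \<tau> powr (- m - 2) * flat (1 - \<tau> powr (m + 1))"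

text \<open>The part of minus the Laplacian in which the cutoff is not differentiated. For m = N / 2
  - 1 the factor in front of \<open>flat\<close> is N (N - 2) e \<tau>^(-(N + 2) / 2), minus the
  Laplacian of the regularised fundamental solution \<tau>^(-m).\<close>

definition pole_kernel :: "real \<Rightarrow> real \<Rightarrow> real \<Rightarrow> real" where
  "pole_kernel m e \<tau> = 4 * m * (m + 1) * e * \<tau> powr (- m - 2) * flat (1 - \<tau> powr (m + 1))"

text \<open>The terms of the Laplacian in which the cutoff is differentiated at least once.\<close>

definition pole_error :: "real \<Rightarrow> real \<Rightarrow> real \<Rightarrow> real" where
  "pole_error m e \<tau> = 4 * (m + 1)\<^sup>2 * (\<tau> - e) * \<tau> powr m * flat2 (1 - \<tau> powr (m + 1))
     + 4 * (m + 1) * (m * (\<tau> - e) / \<tau> - (m + 1)) * flat1 (1 - \<tau> powr (m + 1))"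

lemma pole_deriv:
  assumes "\<tau> > 0"
  shows "(pole m has_real_derivative pole1 m \<tau>) (at \<tau>)"
proof -
  have eq: "flat1 (1 - \<tau> powr (m + 1)) * (- ((m + 1) * \<tau> powr m)) * \<tau> powr (- m)
      = - ((m + 1) * flat1 (1 - \<tau> powr (m + 1)) * (\<tau> powr m * \<tau> powr (- m)))"
    by simp
  have "((\<lambda>\<tau>. flat (1 - \<tau> powr (m + 1)) * \<tau> powr (- m)) has_real_derivative
      flat1 (1 - \<tau> powr (m + 1)) * (- ((m + 1) * \<tau> powr m)) * \<tau> powr (- m)
      + flat (1 - \<tau> powr (m + 1)) * (- m * \<tau> powr (- m - 1))) (at \<tau>)"
    using assms by (auto intro!: derivative_eq_intros DERIV_chain2[OF flat_deriv])
  then show ?thesis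
    unfolding pole_def[abs_def] pole1_def eq mult_minus_left
    using assms by (simp add: mult_ac flip: powr_add)
qed

lemma pole1_deriv:
  assumes "\<tau> > 0"
  shows "(pole1 m has_real_derivative pole2 m \<tau>) (at \<tau>)"
proof -
  have eq: "\<tau> powr (- m - 1) * \<tau> powr m = 1 / \<tau>" "- m - 1 - 1 = - m - 2"
    using assms by (simp_all add: powr_minus_divide flip: powr_add)
  have "(pole1 m has_real_derivative
      - ((m + 1) * (flat2 (1 - \<tau> powr (m + 1)) * (- ((m + 1) * \<tau> powr m))))
      - (m * ((- m - 1) * \<tau> powr (- m - 1 - 1)) * flat (1 - \<tau> powr (m + 1))
        + m * \<tau> powr (- m - 1) * (flat1 (1 - \<tau> powr (m + 1)) * (- ((m + 1) * \<tau> powr m))))) (at \<tau>)"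
    unfolding pole1_def[abs_def]
    using assms by (auto intro!: derivative_eq_intros DERIV_chain2[OF flat_deriv] DERIV_chain2[OF flat1_deriv])
  also have "m * \<tau> powr (- m - 1) * (flat1 (1 - \<tau> powr (m + 1)) * (- ((m + 1) * \<tau> powr m)))
      = - (m * (m + 1) * (\<tau> powr (- m - 1) * \<tau> powr m) * flat1 (1 - \<tau> powr (m + 1)))"
    by (simp add: algebra_simps)
  finally show ?thesis
    unfolding eq pole2_def by (simp add: algebra_simps power2_eq_square add_divide_distrib)
qed

text \<open>For \<open>m = N / 2 - 1\<close> and \<open>\<tau> = \<bar>y\<bar>\<^sup>2 + e\<close>, the left-hand side is the Laplacian of
  \<open>pole m \<tau>\<close> as a function of \<open>y\<close> in dimension \<open>N\<close>. The exponent \<open>m + 1\<close> in the cutoff makes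
  the error term bounded up to the pole.\<close>

lemma pole_laplace:
  assumes "\<tau> > 0"
  shows "4 * (\<tau> - e) * pole2 m \<tau> + 4 * (m + 1) * pole1 m \<tau> = pole_error m e \<tau> - pole_kernel m e \<tau>"
proof -
  have "\<tau> powr (- m - 1) = \<tau> powr (- m - 2 + 1)"
    by (rule arg_cong) simp
  also have "\<dots> = \<tau> * \<tau> powr (- m - 2)"
    using assms by (subst powr_add) simp
  finally have *: "\<tau> powr (- m - 1) = \<tau> * \<tau> powr (- m - 2)" .
  show ?thesis
    unfolding pole1_def pole2_def pole_error_def pole_kernel_def *
    using assms by (simp add: field_simps power2_eq_square)
qed

lemma pole_nonneg: "pole m \<tau> \<ge> 0"
  by (simp add: pole_def flat_nonneg)

lemma pole_le: "pole m \<tau> \<le> \<tau> powr (- m)"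
  using mult_right_mono[OF flat_le_1, of "\<tau> powr (- m)"] by (simp add: pole_def)

lemma pole_support:
  assumes "m > - 1" "\<tau> \<ge> 1"
  shows "pole m \<tau> = 0" "pole_kernel m e \<tau> = 0" "pole_error m e \<tau> = 0"
proof -
  have "1 - \<tau> powr (m + 1) \<le> 0"
    using assms by (simp add: ge_one_powr_ge_zero)
  then show "pole m \<tau> = 0" "pole_kernel m e \<tau> = 0" "pole_error m e \<tau> = 0"
    by (simp_all add: pole_def pole_kernel_def pole_error_def flat_nonpos flat12_nonpos)
qed

lemma pole_kernel_nonneg: "m \<ge> 0 \<Longrightarrow> e \<ge> 0 \<Longrightarrow> pole_kernel m e \<tau> \<ge> 0"
  by (simp add: pole_kernel_def flat_nonneg)

text \<open>The range e \<le> \<tau> \<le> 2e is the ball |y|^2 \<le> e, and e^(-m-1) = e^(-N/2) is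
  the reciprocal of its volume up to a constant: the kernel dominates a normalised indicator. The
  bound e \<le> 1/4 keeps \<tau> \<le> 1/2, where the cutoff is at least
  \<open>flat (1 / 2)\<close>.\<close>

lemma pole_kernel_ge:
  assumes m: "m > 0" and e: "0 < e" "e \<le> \<tau>" "\<tau> \<le> 2 * e" "e \<le> 1 / 4"
  shows "pole_kernel m e \<tau> \<ge> 4 * m * (m + 1) * flat (1 / 2) * 2 powr (- m - 2) * e powr (- m - 1)"
proof -
  have "\<tau> powr (m + 1) \<le> \<tau> powr 1"
    using assms by (intro powr_mono') auto
  then have 1: "flat (1 / 2) \<le> flat (1 - \<tau> powr (m + 1))"
    using e by (intro flat_mono) auto
  have "2 powr (- m - 2) * e powr (- m - 1) = 2 powr (- m - 2) * e powr (- m - 2 + 1)"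
    by (intro arg_cong2[where f = "(*)"] arg_cong2[where f = "(powr)"]) simp_all
  also have "\<dots> = 2 powr (- m - 2) * (e powr (- m - 2) * e)"
    using e by (subst powr_add) simp
  also have "\<dots> = e * (2 * e) powr (- m - 2)"
    using e by (simp add: powr_mult)
  also have "\<dots> \<le> e * \<tau> powr (- m - 2)"
    using assms by (intro mult_left_mono powr_mono2') auto
  finally have "(4 * m * (m + 1)) * ((2 powr (- m - 2) * e powr (- m - 1)) * flat (1 / 2))
      \<le> (4 * m * (m + 1)) * ((e * \<tau> powr (- m - 2)) * flat (1 - \<tau> powr (m + 1)))"
    using m 1 e(1) by (intro mult_left_mono mult_mono[of "_ * _" "_ * _"]) (auto simp: flat_nonneg)
  then show ?thesis
    by (simp add: pole_kernel_def mult_ac)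
qed

lemma add_powr_le:
  fixes a b q :: real
  assumes "a \<ge> 0" "b \<ge> 0" "q \<ge> 0"
  shows "(a + b) powr q \<le> 2 powr q * (a powr q + b powr q)"
proof -
  have "(a + b) powr q \<le> (2 * max a b) powr q"
    using assms by (intro powr_mono2) auto
  also have "\<dots> = 2 powr q * max a b powr q"
    using assms by (simp add: powr_mult)
  also have "max a b powr q \<le> a powr q + b powr q"
    by (auto simp: max_def)
  finally show ?thesis by simp
qed

text \<open>For 0 < e \<le> \<tau> < 1 both coefficients in the error are at most 4 (m + 1)^2 in
  absolute value, so only the derivatives of \<open>flat\<close> matter and the constant does not
  depend on e. The factor \<tau>^(-m) of \<open>pole\<close> can be inserted at the end because it
  is at least 1.\<close>

lemma pole_error_powr_le:
  assumes m: "m > 0" and q: "q > 1"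
  shows "\<exists>C\<ge>0. \<forall>e \<tau>. 0 < e \<longrightarrow> e \<le> \<tau> \<longrightarrow> \<tau> < 1 \<longrightarrow> \<bar>pole_error m e \<tau>\<bar> powr q \<le> C * pole m \<tau>"
proof -
  obtain C1 where C1: "C1 \<ge> 0" "\<And>t. t > 0 \<Longrightarrow> \<bar>flat1 t\<bar> powr q \<le> C1 * flat t"
    using flat_poly_powr_le_flat[OF q] unfolding flat1_def by blast
  obtain C2 where C2: "C2 \<ge> 0" "\<And>t. t > 0 \<Longrightarrow> \<bar>flat2 t\<bar> powr q \<le> C2 * flat t"
    using flat_poly_powr_le_flat[OF q] unfolding flat2_def by blast
  define A where "A = 4 * (m + 1)\<^sup>2"
  have "A > 0" using m by (simp add: A_def)
  define C where "C = A powr q * (2 powr q * (C1 + C2))"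
  have "C \<ge> 0"
    using C1 C2 by (simp add: C_def)
  moreover have "\<bar>pole_error m e \<tau>\<bar> powr q \<le> C * pole m \<tau>" if e: "0 < e" "e \<le> \<tau>" "\<tau> < 1" for e \<tau>
  proof -
    define t where "t = 1 - \<tau> powr (m + 1)"
    have "\<tau> powr (m + 1) < 1 powr (m + 1)"
      using that m by (intro powr_less_mono2) auto
    then have t: "t > 0"
      by (simp add: t_def)
    have "\<tau> powr m \<le> 1"
      using that m by (intro powr_le1) auto
    then have 1: "(\<tau> - e) * \<tau> powr m \<le> 1"
      using that by (intro mult_le_one) auto
    have 2: "\<bar>m * (\<tau> - e) / \<tau> - (m + 1)\<bar> \<le> m + 1"
      using that m by (simp add: abs_le_iff field_simps)
    have "\<bar>pole_error m e \<tau>\<bar> \<le> \<bar>4 * (m + 1)\<^sup>2 * (\<tau> - e) * \<tau> powr m * flat2 t\<bar>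
        + \<bar>4 * (m + 1) * (m * (\<tau> - e) / \<tau> - (m + 1)) * flat1 t\<bar>"
      unfolding pole_error_def t_def by (rule abs_triangle_ineq)
    also have "\<bar>4 * (m + 1)\<^sup>2 * (\<tau> - e) * \<tau> powr m * flat2 t\<bar> = A * (((\<tau> - e) * \<tau> powr m) * \<bar>flat2 t\<bar>)"
      using that m by (simp add: A_def abs_mult)
    also have "\<dots> \<le> A * (1 * \<bar>flat2 t\<bar>)"
      using 1 \<open>A > 0\<close> by (intro mult_left_mono mult_right_mono) auto
    also have "\<bar>4 * (m + 1) * (m * (\<tau> - e) / \<tau> - (m + 1)) * flat1 t\<bar>
        = 4 * (m + 1) * (\<bar>m * (\<tau> - e) / \<tau> - (m + 1)\<bar> * \<bar>flat1 t\<bar>)"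
      using m by (simp add: abs_mult)
    also have "\<dots> \<le> 4 * (m + 1) * ((m + 1) * \<bar>flat1 t\<bar>)"
      using 2 m by (intro mult_left_mono mult_right_mono) auto
    also have "\<dots> = A * \<bar>flat1 t\<bar>"
      by (simp add: A_def power2_eq_square)
    finally have "\<bar>pole_error m e \<tau>\<bar> \<le> A * (\<bar>flat1 t\<bar> + \<bar>flat2 t\<bar>)"
      by (simp add: algebra_simps)
    then have "\<bar>pole_error m e \<tau>\<bar> powr q \<le> (A * (\<bar>flat1 t\<bar> + \<bar>flat2 t\<bar>)) powr q"
      using q by (intro powr_mono2) auto
    also have "\<dots> = A powr q * (\<bar>flat1 t\<bar> + \<bar>flat2 t\<bar>) powr q"
      using \<open>A > 0\<close> by (simp add: powr_mult)
    also have "\<dots> \<le> A powr q * (2 powr q * (\<bar>flat1 t\<bar> powr q + \<bar>flat2 t\<bar> powr q))"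
      using q by (intro mult_left_mono add_powr_le) auto
    also have "\<dots> \<le> A powr q * (2 powr q * (C1 * flat t + C2 * flat t))"
      using C1(2)[OF t] C2(2)[OF t] by (intro mult_left_mono add_mono) auto
    also have "\<dots> = C * flat t * 1"
      by (simp add: C_def algebra_simps)
    also have "\<dots> \<le> C * flat t * \<tau> powr (- m)"
    proof (intro mult_left_mono)
      show "1 \<le> \<tau> powr (- m)"
        using powr_mono'[of "- m" 0 \<tau>] that m by simp
    qed (use \<open>C \<ge> 0\<close> flat_nonneg in auto)
    also have "\<dots> = C * pole m \<tau>"
      by (simp add: pole_def t_def)
    finally show ?thesis .
  qed
  ultimately show ?thesis by blast
qed

section \<open>The test function in space and its Laplacian\<close>

definition laplacian :: "('a::euclidean_space \<Rightarrow> real) \<Rightarrow> 'a \<Rightarrow> real" where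
  "laplacian f x = (\<Sum>b\<in>Basis. frechet_derivative (\<lambda>y. frechet_derivative f (at y) b) (at x) b)"

definition sqdist :: "real \<Rightarrow> real \<Rightarrow> 'a::euclidean_space \<Rightarrow> 'a \<Rightarrow> real" where
  "sqdist R e z x = (x - z) \<bullet> (x - z) / R\<^sup>2 + e"

lemma sqdist_has_derivative:
  "(sqdist R e z has_derivative (\<lambda>h. 2 * ((x - z) \<bullet> h) / R\<^sup>2)) (at x)"
proof -
  have "((\<lambda>x. c * ((x - z) \<bullet> (x - z)) + e) has_derivative (\<lambda>h. c * (2 * ((x - z) \<bullet> h)))) (at x)" for c
    by (auto intro!: derivative_eq_intros simp: inner_commute)
  from this[of "1 / R\<^sup>2"] show ?thesis
    by (simp add: sqdist_def[abs_def])
qed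

lemma smooth_fun_sqdist: "smooth_fun (sqdist R e z)"
proof -
  have 1: "C_k k (\<lambda>x. (x - z) \<bullet> v)" for k and v :: 'a
    using C_k_add[OF C_k_bounded_linear[OF bounded_linear_inner_left[of v]] C_k_const[of k "- (z \<bullet> v)"]]
    by (simp add: inner_diff_left)
  have "C_k k (sqdist R e z)" for k
  proof (cases k)
    case 0
    have "isCont (sqdist R e z) x" for x
      by (rule has_derivative_continuous[OF sqdist_has_derivative])
    with 0 show ?thesis
      by (simp add: continuous_at_imp_continuous_on)
  next
    case (Suc j)
    have "C_k j (\<lambda>x. 2 * ((x - z) \<bullet> b) / R\<^sup>2)" for b
      using C_k_mult[OF C_k_const[of j "2 / R\<^sup>2"] 1[of j b]] by simp
    then show ?thesis
      unfolding Suc by (intro C_k_SucI[OF sqdist_has_derivative])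
  qed
  then show ?thesis
    by (simp add: smooth_fun_def)
qed

lemma sqdist_ge: "sqdist R e z x \<ge> e"
  by (simp add: sqdist_def)

lemma sqdist_less_1_imp:
  assumes "sqdist R e z x < 1" "R > 0" "e > 0"
  shows "x \<in> ball z R"
proof -
  have "(norm (x - z))\<^sup>2 < R\<^sup>2"
    using assms by (simp add: sqdist_def power2_norm_eq_inner field_simps)
      (smt (verit) mult_pos_pos zero_less_power)
  then show ?thesis
    using assms by (simp add: dist_norm norm_minus_commute power2_less_imp_less)
qed

locale pole_test =
  fixes z :: "'a::euclidean_space" and R e m :: real
  assumes R: "R > 0" and e: "e > 0" and m: "m > 0" and dim: "real DIM('a) = 2 * m + 2"
begin

abbreviation "\<tau> \<equiv> sqdist R e z"

definition "\<phi> x = pole m (\<tau> x)"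

lemma \<tau>_pos: "\<tau> x > 0"
  using sqdist_ge[of e R z x] e by linarith

lemma \<phi>_nonneg: "\<phi> x \<ge> 0"
  by (simp add: \<phi>_def pole_nonneg)

lemma \<phi>_smooth: "smooth_fun \<phi>"
proof -
  have "smooth_fun (\<lambda>x. 1 + - 1 * \<tau> x powr (m + 1))"
    using smooth_fun_powr[OF smooth_fun_sqdist \<tau>_pos, of "m + 1"]
    unfolding smooth_fun_def by (intro allI C_k_add C_k_mult C_k_const) blast
  then have "smooth_fun (\<lambda>x. flat (1 - \<tau> x powr (m + 1)))"
    using smooth_fun_flat by fastforce
  then show ?thesis
    unfolding \<phi>_def[abs_def] pole_def
    by (intro smooth_fun_mult smooth_fun_powr smooth_fun_sqdist \<tau>_pos)
qed

lemma \<phi>_nonzero: "\<phi> x \<noteq> 0 \<Longrightarrow> x \<in> ball z R"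
  using pole_support[of m "\<tau> x"] sqdist_less_1_imp[OF _ R e] m unfolding \<phi>_def by (metis less_trans linorder_not_le neg_less_0_iff_less zero_less_one)

lemma \<phi>_test: "cball z R \<subseteq> \<Omega> \<Longrightarrow> \<phi> \<in> test_functions \<Omega>"
proof -
  have "closure {x. \<phi> x \<noteq> 0} \<subseteq> cball z R"
    by (rule closure_minimal) (use \<phi>_nonzero in \<open>auto simp: less_imp_le\<close>)
  then show "cball z R \<subseteq> \<Omega> \<Longrightarrow> \<phi> \<in> test_functions \<Omega>"
    unfolding test_functions_def using \<phi>_smooth compact_Int_closed[of "cball z R" "closure {x. \<phi> x \<noteq> 0}"]
    by (auto simp: Int_absorb1)
qed

lemma \<phi>_partial: "frechet_derivative \<phi> (at x) h = pole1 m (\<tau> x) * (2 * ((x - z) \<bullet> h) / R\<^sup>2)"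
proof -
  have "(\<phi> has_derivative (\<lambda>h. pole1 m (\<tau> x) * (2 * ((x - z) \<bullet> h) / R\<^sup>2))) (at x)"
    unfolding \<phi>_def[abs_def]
    using has_derivative_compose[OF sqdist_has_derivative] pole_deriv[OF \<tau>_pos]
    unfolding has_field_derivative_def by blast
  then show ?thesis
    by (simp add: frechet_derivative_at[symmetric])
qed

lemma \<phi>_partial2:
  assumes "b \<in> Basis"
  shows "frechet_derivative (\<lambda>y. frechet_derivative \<phi> (at y) b) (at x) b =
    pole2 m (\<tau> x) * (2 * ((x - z) \<bullet> b) / R\<^sup>2)\<^sup>2 + 2 * pole1 m (\<tau> x) / R\<^sup>2"
proof -
  have "((\<lambda>y. pole1 m (\<tau> y)) has_derivative (\<lambda>h. pole2 m (\<tau> x) * (2 * ((x - z) \<bullet> h) / R\<^sup>2))) (at x)"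
    using has_derivative_compose[OF sqdist_has_derivative] pole1_deriv[OF \<tau>_pos]
    unfolding has_field_derivative_def by blast
  moreover have "((\<lambda>y. c * ((y - z) \<bullet> b)) has_derivative (\<lambda>h. c * (h \<bullet> b))) (at x)" for c
    by (auto intro!: derivative_eq_intros)
  from this[of "2 / R\<^sup>2"] have "((\<lambda>y. 2 * ((y - z) \<bullet> b) / R\<^sup>2) has_derivative (\<lambda>h. 2 * (h \<bullet> b) / R\<^sup>2)) (at x)"
    by simp
  ultimately have "((\<lambda>y. pole1 m (\<tau> y) * (2 * ((y - z) \<bullet> b) / R\<^sup>2)) has_derivative
      (\<lambda>h. pole1 m (\<tau> x) * (2 * (h \<bullet> b) / R\<^sup>2)
        + pole2 m (\<tau> x) * (2 * ((x - z) \<bullet> h) / R\<^sup>2) * (2 * ((x - z) \<bullet> b) / R\<^sup>2))) (at x)"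
    by (rule has_derivative_mult)
  then show ?thesis
    using assms by (simp add: \<phi>_partial frechet_derivative_at[symmetric] power2_eq_square mult_ac)
qed

text \<open>Summing over the basis turns the squared coordinates into |x - z|^2 = (\<tau> - e) R^2
  and contributes the dimension 2m + 2 to the first-order term; this is the combination evaluated in
  \<open>pole_laplace\<close>.\<close>

lemma \<phi>_laplacian: "laplacian \<phi> x = (pole_error m e (\<tau> x) - pole_kernel m e (\<tau> x)) / R\<^sup>2"
proof -
  have "(\<Sum>b\<in>Basis. ((x - z) \<bullet> b)\<^sup>2) = (x - z) \<bullet> (x - z)"
    by (subst euclidean_inner) (simp add: power2_eq_square)
  then have *: "(\<Sum>b\<in>Basis. ((x - z) \<bullet> b)\<^sup>2) = (\<tau> x - e) * R\<^sup>2"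
    using R by (simp add: sqdist_def)
  have "laplacian \<phi> x = (\<Sum>b\<in>Basis. 4 * pole2 m (\<tau> x) / R ^ 4 * ((x - z) \<bullet> b)\<^sup>2 + 2 * pole1 m (\<tau> x) / R\<^sup>2)"
    unfolding laplacian_def by (intro sum.cong) (auto simp: \<phi>_partial2 power2_eq_square power4_eq_xxxx mult.assoc)
  also have "\<dots> = 4 * pole2 m (\<tau> x) / R ^ 4 * ((\<tau> x - e) * R\<^sup>2) + real DIM('a) * (2 * pole1 m (\<tau> x) / R\<^sup>2)"
    by (simp only: sum.distrib sum_distrib_left[symmetric] * sum_constant)
  also have "\<dots> = (4 * (\<tau> x - e) * pole2 m (\<tau> x) + 4 * (m + 1) * pole1 m (\<tau> x)) / R\<^sup>2"
    using R unfolding dim by (simp add: field_simps power2_eq_square power4_eq_xxxx)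
  finally show ?thesis
    unfolding pole_laplace[OF \<tau>_pos] .
qed

end

section \<open>The weak formulation\<close>

lemma smooth_fun_continuous: "smooth_fun f \<Longrightarrow> continuous_on UNIV f"
  unfolding smooth_fun_def by (metis C_k.simps(1))

lemma test_functions_partial:
  assumes "\<phi> \<in> test_functions \<Omega>" "b \<in> Basis"
  shows "(\<lambda>x. frechet_derivative \<phi> (at x) b) \<in> test_functions \<Omega>"
proof -
  let ?K = "closure {x. \<phi> x \<noteq> 0}"
  have "frechet_derivative \<phi> (at x) b = 0" if "x \<notin> ?K" for x
  proof -
    have "(\<phi> has_derivative (\<lambda>_. 0)) (at x)"
      by (rule has_derivative_transform_within_open[OF has_derivative_const, of "- ?K" _ 0])
         (use that closure_subset[of "{x. \<phi> x \<noteq> 0}"] in auto)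
    then show ?thesis
      by (simp add: frechet_derivative_at[symmetric])
  qed
  then have sub: "closure {x. frechet_derivative \<phi> (at x) b \<noteq> 0} \<subseteq> ?K"
    by (intro closure_minimal) auto
  moreover have "compact ?K"
    using assms by (simp add: test_functions_def)
  ultimately have "compact (closure {x. frechet_derivative \<phi> (at x) b \<noteq> 0})"
    using compact_Int_closed[of ?K "closure {x. frechet_derivative \<phi> (at x) b \<noteq> 0}"] by (simp add: Int_absorb1)
  then show ?thesis
    using assms sub smooth_fun_partial[of \<phi> b] by (auto simp: test_functions_def)
qed

lemma grad_inner_Basis: "b \<in> Basis \<Longrightarrow> grad f x \<bullet> b = frechet_derivative f (at x) b"
  by (simp add: grad_def inner_sum_left_Basis)

lemma set_integrable_loc_times_test:
  fixes f :: "'a::euclidean_space \<Rightarrow> real"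
  assumes f: "loc_integrable_on f \<Omega>" and \<psi>: "\<psi> \<in> test_functions \<Omega>"
  shows "set_integrable lebesgue \<Omega> (\<lambda>x. f x * \<psi> x)"
proof -
  define K where "K = closure {x. \<psi> x \<noteq> 0}"
  have K: "compact K" "K \<subseteq> \<Omega>" and \<psi>_cont: "continuous_on UNIV \<psi>"
    using \<psi> smooth_fun_continuous[of \<psi>] by (simp_all add: test_functions_def K_def)
  have \<psi>0: "\<psi> x = 0" if "x \<notin> K" for x
    using that closure_subset[of "{x. \<psi> x \<noteq> 0}"] unfolding K_def by auto
  obtain B where B: "\<And>x. x \<in> K \<Longrightarrow> \<bar>\<psi> x\<bar> \<le> B"
    using compact_imp_bounded[OF compact_continuous_image[OF continuous_on_subset[OF \<psi>_cont] K(1)]]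
    unfolding bounded_real by auto
  have fK: "integrable lebesgue (\<lambda>x. indicator K x *\<^sub>R f x)"
    using f K by (simp add: loc_integrable_on_def set_integrable_def)
  have [measurable]: "\<psi> \<in> borel_measurable lebesgue"
    using \<psi>_cont by (intro measurable_completion) (simp add: borel_measurable_continuous_onI)
  have "integrable lebesgue (\<lambda>x. (indicator K x *\<^sub>R f x) * \<psi> x)"
  proof (rule Bochner_Integration.integrable_bound)
    show "integrable lebesgue (\<lambda>x. B *\<^sub>R (indicator K x *\<^sub>R f x))"
      by (rule integrable_scaleR_right[OF fK])
    show "(\<lambda>x. (indicator K x *\<^sub>R f x) * \<psi> x) \<in> borel_measurable lebesgue"
      using fK by measurable
    show "AE x in lebesgue. norm ((indicator K x *\<^sub>R f x) * \<psi> x) \<le> norm (B *\<^sub>R (indicator K x *\<^sub>R f x))"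
    proof (intro AE_I2)
      fix x
      show "norm ((indicator K x *\<^sub>R f x) * \<psi> x) \<le> norm (B *\<^sub>R (indicator K x *\<^sub>R f x))"
        using B[of x] mult_right_mono[of "\<bar>\<psi> x\<bar>" "\<bar>B\<bar>" "\<bar>f x\<bar>"]
        by (cases "x \<in> K") (auto simp: abs_mult mult.commute)
    qed
  qed
  also have "(\<lambda>x. (indicator K x *\<^sub>R f x) * \<psi> x) = (\<lambda>x. indicator \<Omega> x *\<^sub>R (f x * \<psi> x))"
    using K(2) \<psi>0 by (auto simp: indicator_def fun_eq_iff)
  finally show ?thesis
    by (simp add: set_integrable_def)
qed

lemma set_integral_sum:
  fixes f :: "'i \<Rightarrow> 'a \<Rightarrow> 'b::{banach, second_countable_topology}"
  assumes "\<And>i. i \<in> I \<Longrightarrow> set_integrable M A (f i)"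
  shows "(LINT x:A|M. (\<Sum>i\<in>I. f i x)) = (\<Sum>i\<in>I. LINT x:A|M. f i x)"
  using assms unfolding set_lebesgue_integral_def set_integrable_def
  by (simp add: scaleR_sum_right Bochner_Integration.integral_sum)

text \<open>Each partial derivative of \<open>\<phi>\<close> is itself a test function, so the
  definition of the weak gradient applies to it; summing over the basis removes \<open>G\<close>
  from the equation and leaves \<open>u\<close> alone.\<close>

lemma has_weak_gradient_laplacian:
  assumes G: "has_weak_gradient \<Omega> u G" and \<phi>: "\<phi> \<in> test_functions \<Omega>"
  shows "(LINT x:\<Omega>|lebesgue. u x * laplacian \<phi> x) = - (LINT x:\<Omega>|lebesgue. G x \<bullet> grad \<phi> x)"
proof -
  define D where "D = (\<lambda>b x. frechet_derivative \<phi> (at x) b)"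
  have D: "D b \<in> test_functions \<Omega>" if "b \<in> Basis" for b
    unfolding D_def using test_functions_partial[OF \<phi> that] .
  have Gb: "loc_integrable_on (\<lambda>x. G x \<bullet> b) \<Omega>" for b
  proof -
    have "set_integrable lebesgue K (\<lambda>x. G x \<bullet> b)" if "set_integrable lebesgue K G" for K
      using integrable_inner_left[of b, OF that[unfolded set_integrable_def]]
      by (simp add: set_integrable_def)
    then show ?thesis
      using G by (auto simp: has_weak_gradient_def loc_integrable_on_def)
  qed
  have u: "loc_integrable_on u \<Omega>"
    using G by (simp add: has_weak_gradient_def)
  have "(LINT x:\<Omega>|lebesgue. u x * laplacian \<phi> x)
      = (LINT x:\<Omega>|lebesgue. (\<Sum>b\<in>Basis. u x * frechet_derivative (D b) (at x) b))"
    by (simp add: laplacian_def sum_distrib_left D_def)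
  also have "\<dots> = (\<Sum>b\<in>Basis. LINT x:\<Omega>|lebesgue. u x * frechet_derivative (D b) (at x) b)"
    by (intro set_integral_sum set_integrable_loc_times_test[OF u] test_functions_partial D) auto
  also have "\<dots> = (\<Sum>b\<in>Basis. - (LINT x:\<Omega>|lebesgue. (G x \<bullet> b) * D b x))"
  proof (intro sum.cong refl)
    fix b :: 'a
    assume b: "b \<in> Basis"
    have "(LINT x:\<Omega>|lebesgue. u x * (grad (D b) x \<bullet> b)) = - (LINT x:\<Omega>|lebesgue. (G x \<bullet> b) * D b x)"
      using G D[OF b] b unfolding has_weak_gradient_def by blast
    then show "(LINT x:\<Omega>|lebesgue. u x * frechet_derivative (D b) (at x) b) = - (LINT x:\<Omega>|lebesgue. (G x \<bullet> b) * D b x)"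
      unfolding grad_inner_Basis[OF b] .
  qed
  also have "\<dots> = - (LINT x:\<Omega>|lebesgue. (\<Sum>b\<in>Basis. (G x \<bullet> b) * D b x))"
    unfolding sum_negf
    by (subst set_integral_sum) (auto intro!: set_integrable_loc_times_test[OF Gb] D)
  also have "(\<lambda>x. \<Sum>b\<in>Basis. (G x \<bullet> b) * D b x) = (\<lambda>x. G x \<bullet> grad \<phi> x)"
  proof
    fix x
    have "G x \<bullet> grad \<phi> x = (\<Sum>b\<in>Basis. (G x \<bullet> b) * (grad \<phi> x \<bullet> b))"
      by (rule euclidean_inner)
    then show "(\<Sum>b\<in>Basis. (G x \<bullet> b) * D b x) = G x \<bullet> grad \<phi> x"
      by (simp add: grad_inner_Basis D_def)
  qed
  finally show ?thesis .
qed

lemma weak_solution_laplacian: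
  assumes "weak_solution \<Omega> \<mu> p q u" "\<phi> \<in> test_functions \<Omega>"
  shows "(LINT x:\<Omega>|lebesgue. u x * laplacian \<phi> x)
      + \<mu> * (LINT x:\<Omega>|lebesgue. u x / (norm x)\<^sup>2 * \<phi> x)
      + (LINT x:\<Omega>|lebesgue. (u x powr p - u x powr q) * \<phi> x) = 0"
proof -
  obtain G where "has_weak_gradient \<Omega> u G"
    and "(LINT x:\<Omega>|lebesgue. G x \<bullet> grad \<phi> x) - \<mu> * (LINT x:\<Omega>|lebesgue. u x / (norm x)\<^sup>2 * \<phi> x)
      = (LINT x:\<Omega>|lebesgue. (u x powr p - u x powr q) * \<phi> x)"
    using assms unfolding weak_solution_def by blast
  with has_weak_gradient_laplacian[OF this(1) assms(2)] show ?thesis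
    by linarith
qed

section \<open>Integral estimates\<close>

lemma nn_integral_lborel_scale:
  fixes f :: "'a::euclidean_space \<Rightarrow> ennreal"
  assumes [measurable]: "f \<in> borel_measurable borel" and c: "c > 0"
  shows "(\<integral>\<^sup>+x. f x \<partial>lborel) = ennreal (c ^ DIM('a)) * (\<integral>\<^sup>+x. f (z + c *\<^sub>R x) \<partial>lborel)"
  using c by (subst lborel_affine[of c z]) (simp_all add: nn_integral_density nn_integral_distr nn_integral_cmult)

lemma nn_integral_add_cmult_indicator:
  fixes f :: "'a \<Rightarrow> ennreal"
  assumes f: "f \<in> borel_measurable M" and A: "A \<in> sets M" and B: "B \<in> sets M"
  shows "(\<integral>\<^sup>+x. c * indicator A x + f x * indicator B x \<partial>M)
    = c * emeasure M A + (\<integral>\<^sup>+x. f x * indicator B x \<partial>M)"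
proof -
  have 1: "(\<lambda>x. c * indicator A x) \<in> borel_measurable M"
    using A by simp
  have 2: "(\<lambda>x. f x * indicator B x) \<in> borel_measurable M"
    using f B by simp
  show ?thesis
    unfolding nn_integral_add[OF 1 2] nn_integral_cmult_indicator[OF A] ..
qed

text \<open>Self-similarity: the integral over the ball of half the radius is at most a quarter of the
  integral over the unit ball.\<close>

lemma nn_integral_pole_unit_ball:
  fixes m :: real
  assumes m: "m > 0" and e: "e > 0" and dim: "real DIM('a::euclidean_space) = 2 * m + 2"
  shows "(\<integral>\<^sup>+(x::'a). ennreal (((norm x)\<^sup>2 + e) powr (- m)) * indicator (ball 0 1) x \<partial>lborel)
    \<le> ennreal (2 * 4 powr m * measure lborel (ball (0::'a) 1))"
proof -
  define f where "f = (\<lambda>e (x::'a). ennreal (((norm x)\<^sup>2 + e) powr (- m)))"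
  have [measurable]: "f e \<in> borel_measurable borel" for e
    unfolding f_def by measurable
  have f_meas: "f e \<in> borel_measurable lborel" for e
    by simp
  define I where "I = (\<integral>\<^sup>+x. f e x * indicator (ball 0 1) x \<partial>lborel)"
  define V where "V = emeasure lborel (ball (0::'a) 1)"
  have V: "V = ennreal (measure lborel (ball (0::'a) 1))"
    unfolding V_def using emeasure_lborel_ball_finite[of "0::'a" 1] by (intro emeasure_eq_ennreal_measure) auto
  \<comment> \<open>A crude bound depending on e, used only to know that \<open>I\<close> is finite:
    without this, a quarter of \<open>I\<close> could not be absorbed into the left-hand side
    below.\<close>
  have "I \<le> (\<integral>\<^sup>+(x::'a). ennreal (e powr (- m)) * indicator (ball 0 1) x \<partial>lborel)"
    unfolding I_def f_def using m e
    by (intro nn_integral_mono) (auto intro!: ennreal_leI powr_mono2' simp: indicator_def)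
  also have "\<dots> = ennreal (e powr (- m)) * V"
    unfolding V_def by (rule nn_integral_cmult_indicator) simp
  finally have I_fin: "I \<noteq> \<infinity>"
    unfolding V by (auto simp: top_unique ennreal_mult_eq_top_iff)
  have "I \<le> (\<integral>\<^sup>+x. ennreal (4 powr m) * indicator (ball 0 1) x + f e x * indicator (ball 0 (1/2)) x \<partial>lborel)"
    unfolding I_def
  proof (intro nn_integral_mono)
    fix x :: 'a
    show "f e x * indicator (ball 0 1) x \<le> ennreal (4 powr m) * indicator (ball 0 1) x + f e x * indicator (ball 0 (1/2)) x"
    proof (cases "norm x < 1/2")
      case False
      then have "(1/2)\<^sup>2 \<le> (norm x)\<^sup>2"
        by (intro power_mono) auto
      then have "1 / 4 \<le> (norm x)\<^sup>2 + e"
        using e by (simp add: power2_eq_square)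
      then have "((norm x)\<^sup>2 + e) powr (- m) \<le> (1 / 4) powr (- m)"
        using m by (intro powr_mono2') auto
      also have "\<dots> = 4 powr m"
        by (simp add: powr_minus powr_divide)
      finally have "f e x \<le> ennreal (4 powr m)"
        unfolding f_def by (rule ennreal_leI)
      then show ?thesis
        using False by (auto simp: indicator_def)
    qed (auto simp: indicator_def)
  qed
  also have "\<dots> = ennreal (4 powr m) * V + (\<integral>\<^sup>+x. f e x * indicator (ball 0 (1/2)) x \<partial>lborel)"
    unfolding V_def by (rule nn_integral_add_cmult_indicator[OF f_meas]) simp_all
  also have "(\<integral>\<^sup>+x. f e x * indicator (ball 0 (1/2)) x \<partial>lborel)
     = ennreal ((1/2) ^ DIM('a)) * (\<integral>\<^sup>+x. f e ((1/2) *\<^sub>R x) * indicator (ball 0 1) x \<partial>lborel)"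
    by (subst nn_integral_lborel_scale[of _ "1/2" 0])
       (auto intro!: arg_cong2[where f = "(*)"] nn_integral_cong simp: indicator_def)
  also have "(\<integral>\<^sup>+x. f e ((1/2) *\<^sub>R x) * indicator (ball 0 1) x \<partial>lborel)
     \<le> (\<integral>\<^sup>+x. ennreal (4 powr m) * (f e x * indicator (ball 0 1) x) \<partial>lborel)"
  proof (intro nn_integral_mono)
    fix x :: 'a
    \<comment> \<open>The regularisation e is not rescaled along with x; an inequality in the
      favourable direction is enough.\<close>
    have "(norm ((1/2) *\<^sub>R x))\<^sup>2 + e \<ge> (1/4) * ((norm x)\<^sup>2 + e)"
      using e by (simp add: power2_eq_square)
    then have "((norm ((1/2) *\<^sub>R x))\<^sup>2 + e) powr (- m) \<le> ((1/4) * ((norm x)\<^sup>2 + e)) powr (- m)"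
      using m e by (intro powr_mono2') (auto intro!: add_nonneg_pos)
    also have "\<dots> = 4 powr m * ((norm x)\<^sup>2 + e) powr (- m)"
      using e by (subst powr_mult) (auto simp: powr_minus powr_divide)
    finally have "f e ((1/2) *\<^sub>R x) \<le> ennreal (4 powr m) * f e x"
      unfolding f_def by (simp add: ennreal_leI flip: ennreal_mult)
    then show "f e ((1/2) *\<^sub>R x) * indicator (ball 0 1) x \<le> ennreal (4 powr m) * (f e x * indicator (ball 0 1) x)"
      by (auto simp: indicator_def)
  qed
  also have "\<dots> = ennreal (4 powr m) * I"
    unfolding I_def
    by (rule nn_integral_cmult, rule borel_measurable_times_ennreal[OF f_meas borel_measurable_indicator]) simp
  \<comment> \<open>The Jacobian 2^(-N) against the homogeneity factor 4^m, with N = 2m + 2, leaves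
    exactly 1/4.\<close>
  also have "ennreal ((1/2) ^ DIM('a)) * (ennreal (4 powr m) * I) = ennreal (1 / 4) * I"
  proof -
    have "(1/2::real) ^ DIM('a) * 4 powr m = (1/2) powr (2 * m + 2) * 4 powr m"
      unfolding dim[symmetric] by (simp add: powr_realpow)
    also have "(1/2::real) powr (2 * m + 2) = ((1/2) powr 2) powr (m + 1)"
      by (subst powr_powr) (simp add: algebra_simps)
    also have "\<dots> = (1/4) powr (m + 1)"
      by (simp add: power2_eq_square)
    also have "\<dots> = 4 powr (- (m + 1))"
      unfolding powr_minus_divide by (simp add: powr_divide)
    also have "4 powr (- (m + 1)) * 4 powr m = (4::real) powr (- 1)"
      by (simp flip: powr_add)
    also have "\<dots> = 1 / 4"
      by (simp add: powr_minus_divide)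
    finally have "(1/2::real) ^ DIM('a) * 4 powr m = 1 / 4" .
    moreover have "ennreal ((1/2) ^ DIM('a)) * (ennreal (4 powr m) * I) = ennreal ((1/2) ^ DIM('a) * 4 powr m) * I"
      by (subst ennreal_mult) (auto simp: mult.assoc)
    ultimately show ?thesis by (simp only:)
  qed
  finally have *: "I \<le> ennreal (4 powr m) * V + ennreal (1 / 4) * I"
    by (simp add: mult_left_mono add_left_mono)
  obtain r where r: "I = ennreal r" "r \<ge> 0"
    using I_fin by (cases I) auto
  have "r \<le> 4 powr m * measure lborel (ball (0::'a) 1) + 1 / 4 * r"
    using * r unfolding V r by (simp flip: ennreal_mult ennreal_plus)
  moreover have "0 \<le> 4 powr m * measure lborel (ball (0::'a) 1)"
    by simp
  \<comment> \<open>Absorbing the quarter gives the factor 4/3, rounded up to 2.\<close>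
  ultimately have "r \<le> 2 * (4 powr m * measure lborel (ball (0::'a) 1))"
    by linarith
  then show ?thesis
    using r unfolding I_def f_def by (simp add: ennreal_leI mult.assoc)
qed

lemma nn_integral_pole_ball:
  fixes z :: "'a::euclidean_space"
  assumes m: "m > 0" and e: "e > 0" and dim: "real DIM('a) = 2 * m + 2" and R: "R > 0"
  shows "(\<integral>\<^sup>+x. ennreal (((x - z) \<bullet> (x - z) / R\<^sup>2 + e) powr (- m)) * indicator (ball z R) x \<partial>lborel)
    \<le> ennreal (2 * 4 powr m * measure lborel (ball (0::'a) 1) * R ^ DIM('a))"
proof -
  have "R * (R * a) / R\<^sup>2 = a" for a
    using R by (simp add: power2_eq_square)
  then have "(\<integral>\<^sup>+x. ennreal (((x - z) \<bullet> (x - z) / R\<^sup>2 + e) powr (- m)) * indicator (ball z R) x \<partial>lborel)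
    = ennreal (R ^ DIM('a)) * (\<integral>\<^sup>+x. ennreal (((norm x)\<^sup>2 + e) powr (- m)) * indicator (ball (0::'a) 1) x \<partial>lborel)"
    using R by (subst nn_integral_lborel_scale[of _ R z])
       (auto intro!: arg_cong2[where f = "(*)"] nn_integral_cong
          simp: indicator_def dist_norm power2_norm_eq_inner simp flip: power2_eq_square)
  also have "\<dots> \<le> ennreal (R ^ DIM('a)) * ennreal (2 * 4 powr m * measure lborel (ball (0::'a) 1))"
    by (intro mult_left_mono nn_integral_pole_unit_ball assms) auto
  finally show ?thesis
    using R by (simp add: mult.commute flip: ennreal_mult)
qed

text \<open>A one-sided Lebesgue differentiation theorem, proved by Vitali covering. On a set of
  measure s where v \<ge> M + \<delta>, choose an open superset with excess at most \<epsilon> and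
  disjoint small balls inside it that cover the set up to a null set. Then (M + \<delta>) s \<le> M
  (s + \<epsilon>), so \<delta> s \<le> M \<epsilon> for every \<epsilon> > 0 and s = 0.\<close>

lemma AE_le_of_ball_integrals:
  fixes v :: "'a::euclidean_space \<Rightarrow> ennreal" and M :: real
  assumes U: "open U" and [measurable]: "v \<in> borel_measurable lebesgue" and M: "M \<ge> 0"
    and avg: "\<And>x. x \<in> U \<Longrightarrow> \<exists>r0>0. \<forall>r. 0 < r \<longrightarrow> r < r0 \<longrightarrow>
      (\<integral>\<^sup>+y. v y * indicator (ball x r) y \<partial>lebesgue) \<le> ennreal M * emeasure lebesgue (ball x r)"
  shows "AE x\<in>U in lebesgue. v x \<le> ennreal M"
proof -
  obtain r0 where r0: "\<And>x. x \<in> U \<Longrightarrow> r0 x > 0"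
    and r0_avg: "\<And>x r. x \<in> U \<Longrightarrow> 0 < r \<Longrightarrow> r < r0 x \<Longrightarrow>
      (\<integral>\<^sup>+y. v y * indicator (ball x r) y \<partial>lebesgue) \<le> ennreal M * emeasure lebesgue (ball x r)"
    using avg by metis
  \<comment> \<open>One index serves both purposes: the intersection with a bounded ball makes the
    measure finite, and the gap 1 / (n + 1) lets the sets exhaust the part of \<open>U\<close> where
    v > M.\<close>
  define S where "S = (\<lambda>n::nat. {x \<in> U \<inter> ball 0 (real n). v x \<ge> ennreal (M + 1 / real (Suc n))})"
  have [measurable]: "U \<in> sets lebesgue"
    using U by (simp add: borel_open)
  have S_sets: "S n \<in> sets lebesgue" for n
  proof -
    have "{x \<in> space lebesgue. v x \<ge> ennreal (M + 1 / real (Suc n))} \<in> sets lebesgue"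
      by measurable
    then have "{x. v x \<ge> ennreal (M + 1 / real (Suc n))} \<in> sets lebesgue"
      by simp
    moreover have "S n = U \<inter> ball 0 (real n) \<inter> {x. v x \<ge> ennreal (M + 1 / real (Suc n))}"
      by (auto simp: S_def)
    ultimately show ?thesis
      by (auto intro!: sets.Int)
  qed
  have S_fin: "emeasure lebesgue (S n) < \<infinity>" for n
  proof -
    have "emeasure lebesgue (S n) \<le> emeasure lebesgue (ball (0::'a) (real n))"
      by (intro emeasure_mono) (auto simp: S_def)
    also have "\<dots> < \<infinity>"
      using emeasure_lborel_ball_finite[of "0::'a" "real n"] by simp
    finally show ?thesis .
  qed
  have S_null: "emeasure lebesgue (S n) = 0" for n
  proof -
    define s where "s = measure lebesgue (S n)"
    have s: "emeasure lebesgue (S n) = ennreal s"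
      unfolding s_def using S_fin[of n] by (intro emeasure_eq_ennreal_measure) auto
    define \<delta> where "\<delta> = 1 / real (Suc n)"
    have le: "\<delta> * s \<le> M * \<epsilon>" if "\<epsilon> > 0" for \<epsilon>
    proof -
      obtain T where T: "open T" "S n \<subseteq> T" "T - S n \<in> lmeasurable" "emeasure lebesgue (T - S n) < ennreal \<epsilon>"
        using sets_lebesgue_outer_open[OF S_sets[of n] \<open>\<epsilon> > 0\<close>] .
      define K where "K = {(x, r). x \<in> S n \<and> 0 < r \<and> r < r0 x \<and> ball x r \<subseteq> T}"
      have "\<exists>i. i \<in> K \<and> x \<in> ball (fst i) (snd i) \<and> snd i < d" if x: "x \<in> S n" and "0 < d" for x d
      proof -
        obtain e where e: "e > 0" "ball x e \<subseteq> T"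
          using openE[OF T(1)] T(2) x by blast
        define r where "r = min e (min d (r0 x)) / 2"
        have "r0 x > 0"
          using r0 x by (auto simp: S_def)
        with e \<open>0 < d\<close> have r: "0 < r" "r < e" "r < d" "r < r0 x"
          by (auto simp: r_def)
        then have "ball x r \<subseteq> T"
          using e subset_ball[of r e x] by auto
        with r x show ?thesis
          by (intro exI[of _ "(x, r)"]) (auto simp: K_def)
      qed
      from Vitali_covering_theorem_balls[of "S n" K fst snd, OF this]
      obtain C where C: "countable C" "C \<subseteq> K"
          "pairwise (\<lambda>i j. disjnt (ball (fst i) (snd i)) (ball (fst j) (snd j))) C"
          "negligible (S n - (\<Union>i\<in>C. ball (fst i) (snd i)))"
        by blast
      define B where "B = (\<lambda>i::'a \<times> real. ball (fst i) (snd i))"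
      have disj: "disjoint_family_on B C"
        using C(3) by (auto simp: disjoint_family_on_def pairwise_def disjnt_def B_def)
      have BK: "(\<integral>\<^sup>+y. v y * indicator (B i) y \<partial>lebesgue) \<le> ennreal M * emeasure lebesgue (B i)" "B i \<subseteq> T"
        if "i \<in> C" for i
      proof -
        have "i \<in> K"
          using that C(2) by blast
        then show "(\<integral>\<^sup>+y. v y * indicator (B i) y \<partial>lebesgue) \<le> ennreal M * emeasure lebesgue (B i)" "B i \<subseteq> T"
          using r0_avg[of "fst i" "snd i"] by (auto simp: K_def B_def S_def)
      qed
      have U_sets: "(\<Union>i\<in>C. B i) \<in> sets lebesgue"
        using C(1) by (auto simp: B_def)
      define \<nu> where "\<nu> = density lebesgue v"
      have "ennreal (M + \<delta>) * emeasure lebesgue (S n) = (\<integral>\<^sup>+y. ennreal (M + \<delta>) * indicator (S n) y \<partial>lebesgue)"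
        using S_sets[of n] by (simp add: nn_integral_cmult_indicator)
      also have "\<dots> \<le> (\<integral>\<^sup>+y. v y * indicator (\<Union>i\<in>C. B i) y \<partial>lebesgue)"
      proof (rule nn_integral_mono_AE)
        have "AE y in lebesgue. y \<notin> S n - (\<Union>i\<in>C. B i)"
          using C(4) by (intro AE_not_in) (simp add: negligible_iff_null_sets B_def)
        then show "AE y in lebesgue. ennreal (M + \<delta>) * indicator (S n) y \<le> v y * indicator (\<Union>i\<in>C. B i) y"
          by eventually_elim (auto simp: indicator_def S_def \<delta>_def)
      qed
      also have "\<dots> = emeasure \<nu> (\<Union>i\<in>C. B i)"
        unfolding \<nu>_def using U_sets by (subst emeasure_density) auto
      also have "\<dots> = (\<integral>\<^sup>+i. emeasure \<nu> (B i) \<partial>count_space C)"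
        using C(1) disj by (intro emeasure_UN_countable) (auto simp: \<nu>_def B_def)
      also have "\<dots> \<le> (\<integral>\<^sup>+i. ennreal M * emeasure lebesgue (B i) \<partial>count_space C)"
        using BK(1) by (intro nn_integral_mono) (auto simp: \<nu>_def emeasure_density B_def)
      also have "\<dots> = ennreal M * (\<integral>\<^sup>+i. emeasure lebesgue (B i) \<partial>count_space C)"
        by (rule nn_integral_cmult) simp
      also have "(\<integral>\<^sup>+i. emeasure lebesgue (B i) \<partial>count_space C) = emeasure lebesgue (\<Union>i\<in>C. B i)"
        using C(1) disj by (intro emeasure_UN_countable[symmetric]) (auto simp: B_def)
      also have "\<dots> \<le> emeasure lebesgue (S n \<union> (T - S n))"
        using BK(2) S_sets[of n] T by (intro emeasure_mono) (auto simp: fmeasurableD)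
      also have "\<dots> \<le> emeasure lebesgue (S n) + emeasure lebesgue (T - S n)"
        using S_sets[of n] T by (intro emeasure_subadditive) (auto simp: fmeasurableD)
      also have "\<dots> \<le> ennreal s + ennreal \<epsilon>"
        using T(4) s by (intro add_mono) auto
      finally have "ennreal (M + \<delta>) * ennreal s \<le> ennreal M * (ennreal s + ennreal \<epsilon>)"
        by (simp add: s mult_left_mono)
      then have "(M + \<delta>) * s \<le> M * (s + \<epsilon>)"
        using M \<open>\<epsilon> > 0\<close> by (simp add: \<delta>_def s_def flip: ennreal_mult ennreal_plus)
      then show ?thesis
        by (simp add: algebra_simps)
    qed
    have "\<delta> * s \<le> 0"
    proof (rule field_le_epsilon)
      fix \<eta> :: real
      assume "\<eta> > 0"
      \<comment> \<open>The denominator is M + 1 because M may be 0.\<close>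
      then have "\<delta> * s \<le> M * (\<eta> / (M + 1))"
        using M by (intro le) auto
      also have "\<dots> \<le> \<eta>"
        using M \<open>\<eta> > 0\<close> by (simp add: field_simps)
      finally show "\<delta> * s \<le> 0 + \<eta>" by simp
    qed
    then have "s \<le> 0"
      by (simp add: \<delta>_def divide_le_0_iff)
    then show ?thesis
      by (simp add: s ennreal_neg)
  qed
  have "AE x in lebesgue. x \<notin> S n" for n
    using S_null S_sets by (intro AE_not_in) (simp add: null_sets_def)
  then have "AE x in lebesgue. \<forall>n. x \<notin> S n"
    by (simp add: AE_all_countable)
  then show ?thesis
  proof eventually_elim
    fix x
    assume *: "\<forall>n. x \<notin> S n"
    show "x \<in> U \<longrightarrow> v x \<le> ennreal M"
    proof (rule impI, rule ennreal_le_epsilon)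
      fix e :: real
      assume x: "x \<in> U" and e: "e > 0"
      obtain n1 where n1: "norm x < real n1"
        using reals_Archimedean2 by blast
      obtain n2 where n2: "1 / real (Suc n2) < e"
        using e nat_approx_posE by blast
      define n where "n = max n1 n2"
      have "1 / real (Suc n) \<le> 1 / real (Suc n2)"
        by (intro divide_left_mono) (auto simp: n_def)
      moreover have "norm x < real n"
        using n1 by (auto simp: n_def)
      ultimately have "v x < ennreal (M + 1 / real (Suc n))"
        using *[rule_format, of n] x by (auto simp: S_def not_le)
      also have "\<dots> \<le> ennreal (M + e)"
        using n2 \<open>1 / real (Suc n) \<le> 1 / real (Suc n2)\<close> by (intro ennreal_leI) auto
      also have "\<dots> = ennreal M + ennreal e"
        using M e by simp
      finally show "v x \<le> ennreal M + ennreal e"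
        by simp
    qed
  qed
qed

section \<open>The Keller-Osserman estimate\<close>

text \<open>Young's inequality by a dichotomy: either 3B \<le> t^(q-1), and the first summand
  suffices, or t is less than (3B)^(1/(q-1)), and the second does. The share 1/3 is chosen because
  three terms will have to be absorbed into one power t^q; the next lemma uses the same dichotomy
  for t^p.\<close>

lemma mult_le_powr_add:
  fixes t B q :: real
  assumes q: "q > 1" and t: "t > 0" and B: "B \<ge> 0"
  shows "t * B \<le> t powr q / 3 + (3 * B) powr (q / (q - 1))"
proof (cases "3 * B \<le> t powr (q - 1)")
  case True
  then have "t * (3 * B) \<le> t * t powr (q - 1)"
    using t by (intro mult_left_mono) auto
  also have "\<dots> = t powr q"
    using powr_add[of t 1 "q - 1"] t by simp
  finally have "t * B \<le> t powr q / 3" by simp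
  then show ?thesis
    by (simp add: add_increasing2)
next
  case False
  have "t = (t powr (q - 1)) powr (1 / (q - 1))"
    using t q by (simp add: powr_powr)
  also have "\<dots> \<le> (3 * B) powr (1 / (q - 1))"
    using False q by (intro powr_mono2) auto
  finally have "t * (3 * B) \<le> (3 * B) powr (1 / (q - 1)) * (3 * B)"
    using B by (intro mult_right_mono) auto
  also have "\<dots> = (3 * B) powr (q / (q - 1))"
  proof -
    have "q / (q - 1) = 1 / (q - 1) + 1"
      using q by (simp add: field_simps)
    then show ?thesis
      using B by (simp add: powr_add)
  qed
  finally have "t * B \<le> (3 * B) powr (q / (q - 1))"
    using t B by (smt (verit) mult_nonneg_nonneg mult_left_mono)
  then show ?thesis
    by (simp add: add_increasing)
qed

lemma powr_le_powr_add:
  fixes t p q :: real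
  assumes "p > 0" "p < q" "t > 0"
  shows "t powr p \<le> t powr q / 3 + 3 powr (p / (q - p))"
proof (cases "3 \<le> t powr (q - p)")
  case True
  then have "t powr p * 3 \<le> t powr p * t powr (q - p)"
    by (intro mult_left_mono) auto
  also have "\<dots> = t powr q"
    by (simp flip: powr_add)
  finally have "t powr p \<le> t powr q / 3" by simp
  then show ?thesis
    by (simp add: add_increasing2)
next
  case False
  have "t powr p = (t powr (q - p)) powr (p / (q - p))"
    using assms by (simp add: powr_powr)
  also have "\<dots> \<le> 3 powr (p / (q - p))"
    using False assms by (intro powr_mono2) auto
  finally show ?thesis
    by (simp add: add_increasing)
qed

text \<open>Here \<open>t\<close> stands for u(x) and \<open>n\<close> for |x|. The error, the Hardy
  term and t^p each use a third of t^q times \<open>pole m \<tau>\<close>. For the error this leaves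
  a remainder without the factor \<open>pole m \<tau>\<close>, for the other two a remainder with
  it; hence the factor \<open>1 + pole m \<tau>\<close>.\<close>

lemma keller_osserman_absorption:
  assumes m: "m > 0" and p: "p > 0" and pq: "p < q" and q: "q > 1" and \<mu>: "\<mu> \<ge> 0"
  shows "\<exists>C\<ge>0. \<forall>e \<tau> t R n. 0 < e \<longrightarrow> e \<le> \<tau> \<longrightarrow> \<tau> < 1 \<longrightarrow> 0 < t \<longrightarrow> 0 < R \<longrightarrow> R \<le> 1 \<longrightarrow> R \<le> n \<longrightarrow>
    t * pole_error m e \<tau> / R\<^sup>2 + \<mu> * (t / n\<^sup>2 * pole m \<tau>) + (t powr p - t powr q) * pole m \<tau>
      \<le> C * R powr (- (2 * q / (q - 1))) * (1 + pole m \<tau>)"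
proof -
  obtain C0 where C0: "C0 \<ge> 0"
    "\<And>e \<tau>. 0 < e \<Longrightarrow> e \<le> \<tau> \<Longrightarrow> \<tau> < 1 \<Longrightarrow> \<bar>pole_error m e \<tau>\<bar> powr q \<le> C0 * pole m \<tau>"
    using pole_error_powr_le[OF m q] by blast
  define s where "s = q / (q - 1)"
  have s: "s > 0" "s = 1 / (q - 1) + 1"
    using q by (auto simp: s_def field_simps)
  define C1 where "C1 = 3 powr s * C0 powr (1 / (q - 1))"
  define C2 where "C2 = (3 * \<mu>) powr s"
  define C3 where "C3 = (3::real) powr (p / (q - p))"
  have C: "C1 \<ge> 0" "C2 \<ge> 0" "C3 \<ge> 0"
    by (simp_all add: C1_def C2_def C3_def)
  have "t * pole_error m e \<tau> / R\<^sup>2 + \<mu> * (t / n\<^sup>2 * pole m \<tau>) + (t powr p - t powr q) * pole m \<tau>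
      \<le> (C1 + C2 + C3) * R powr (- (2 * q / (q - 1))) * (1 + pole m \<tau>)"
    if h: "0 < e" "e \<le> \<tau>" "\<tau> < 1" "0 < t" "0 < R" "R \<le> 1" "R \<le> n" for e \<tau> t R n
  proof -
    define \<phi> where "\<phi> = pole m \<tau>"
    define E where "E = \<bar>pole_error m e \<tau>\<bar>"
    define K where "K = R powr (- (2 * s))"
    have K: "(1 / R\<^sup>2) powr s = K"
    proof -
      have "1 / R\<^sup>2 = R powr (- 2)"
        using h by (simp add: powr_minus_divide)
      then show ?thesis
        by (simp add: K_def powr_powr)
    qed
    \<comment> \<open>Since R \<le> 1, the power of R also dominates the remainder from t^p, which
      does not scale with R.\<close>
    have K1: "K \<ge> 1"
      unfolding K_def using powr_mono'[of "- (2 * s)" 0 R] h s by simp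
    have \<phi>: "\<phi> \<ge> 0"
      by (simp add: \<phi>_def pole_nonneg)
    have Eq: "E powr q \<le> C0 * \<phi>"
      using C0(2)[of e \<tau>] h by (simp add: E_def \<phi>_def)
    have 1: "t * E / R\<^sup>2 \<le> \<phi> * (t powr q / 3) + C1 * K"
    proof (cases "\<phi> = 0")
      case True
      then have "E = 0"
        using Eq by (simp add: E_def)
      then show ?thesis
        using True C K1 by simp
    next
      case False
      with \<phi> have \<phi>0: "\<phi> > 0" by simp
      \<comment> \<open>Young's inequality with B = E / (\<phi> R^2) and s = q / (q - 1) leaves
        \<phi> (E / \<phi>)^s = (E^q)^(1/(q-1)) \<phi>^(-1/(q-1)). As E^q \<le> C0 \<phi>, the
        powers of \<phi> cancel, and the remainder stays bounded where the cutoff vanishes.\<close>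
      have "t * E / R\<^sup>2 = \<phi> * (t * (E / \<phi> * (1 / R\<^sup>2)))"
        using \<phi>0 by simp
      also have "\<dots> \<le> \<phi> * (t powr q / 3 + (3 * (E / \<phi> * (1 / R\<^sup>2))) powr s)"
        unfolding s_def using h q \<phi>0 by (intro mult_left_mono mult_le_powr_add) (auto simp: E_def)
      also have "(3 * (E / \<phi> * (1 / R\<^sup>2))) powr s = 3 powr s * (E / \<phi>) powr s * K"
        unfolding K[symmetric] mult.assoc[symmetric] by (simp only: powr_mult)
      also have "(E / \<phi>) powr s = (E powr q) powr (1 / (q - 1)) / \<phi> powr s"
        using \<phi>0 by (simp add: powr_divide E_def powr_powr s_def)
      finally have "t * E / R\<^sup>2 \<le> \<phi> * (t powr q / 3) + 3 powr s * (E powr q) powr (1 / (q - 1)) * (\<phi> / \<phi> powr s) * K"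
        by (simp add: algebra_simps)
      also have "3 powr s * (E powr q) powr (1 / (q - 1)) * (\<phi> / \<phi> powr s) * K
          \<le> 3 powr s * (C0 * \<phi>) powr (1 / (q - 1)) * (\<phi> / \<phi> powr s) * K"
        using Eq q \<phi>0 K1 by (intro mult_right_mono mult_left_mono powr_mono2) auto
      also have "\<dots> = C1 * K * (\<phi> powr (1 / (q - 1)) * \<phi> / \<phi> powr s)"
        using \<phi>0 C0 by (simp add: C1_def powr_mult)
      also have "\<phi> powr (1 / (q - 1)) * \<phi> / \<phi> powr s = 1"
        unfolding s(2) powr_add using \<phi>0 by simp
      finally show ?thesis by simp
    qed
    have 2: "\<mu> * (t / n\<^sup>2 * \<phi>) \<le> \<phi> * (t powr q / 3) + C2 * K * \<phi>"
    proof -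
      have "1 / n\<^sup>2 \<le> 1 / R\<^sup>2"
        using h by (intro divide_left_mono power_mono) auto
      then have "\<phi> * (t * (\<mu> * (1 / n\<^sup>2))) \<le> \<phi> * (t * (\<mu> * (1 / R\<^sup>2)))"
        using h \<mu> \<phi> by (intro mult_left_mono) auto
      also have "\<dots> \<le> \<phi> * (t powr q / 3 + (3 * (\<mu> * (1 / R\<^sup>2))) powr s)"
        unfolding s_def using h q \<phi> \<mu> by (intro mult_left_mono mult_le_powr_add) auto
      also have "(3 * (\<mu> * (1 / R\<^sup>2))) powr s = ((3 * \<mu>) * (1 / R\<^sup>2)) powr s"
        by (simp only: mult.assoc)
      also have "\<dots> = C2 * K"
        unfolding C2_def K[symmetric] by (rule powr_mult)
      finally show ?thesis
        by (simp add: algebra_simps)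
    qed
    have "t powr p * \<phi> \<le> (t powr q / 3 + C3) * \<phi>"
      unfolding C3_def using h p pq \<phi> by (intro mult_right_mono powr_le_powr_add) auto
    moreover have "C3 * \<phi> * 1 \<le> C3 * \<phi> * K"
      using K1 C \<phi> by (intro mult_left_mono) auto
    ultimately have 3: "t powr p * \<phi> \<le> \<phi> * (t powr q / 3) + C3 * K * \<phi>"
      by (simp add: algebra_simps)
    have "t * pole_error m e \<tau> / R\<^sup>2 \<le> t * E / R\<^sup>2"
      using h by (intro divide_right_mono mult_left_mono) (auto simp: E_def)
    with 1 2 3 have "t * pole_error m e \<tau> / R\<^sup>2 + \<mu> * (t / n\<^sup>2 * \<phi>) + (t powr p - t powr q) * \<phi>
        \<le> C1 * K + C2 * K * \<phi> + C3 * K * \<phi>"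
      by (simp add: algebra_simps)
    also have "\<dots> \<le> (C1 + C2 + C3) * K * (1 + \<phi>)"
      using C K1 \<phi> by (simp add: algebra_simps)
    finally show ?thesis
      unfolding \<phi>_def K_def s_def by simp
  qed
  with C show ?thesis
    by (intro exI[of _ "C1 + C2 + C3"]) auto
qed

section \<open>Integrability, and the equation tested away from the origin\<close>

lemma loc_integrable_powr:
  fixes u :: "'a::euclidean_space \<Rightarrow> real"
  assumes u: "u \<in> Lebesgue_space r \<Omega>" and pos: "AE x\<in>\<Omega> in lebesgue. u x > 0"
    and s: "0 \<le> s" "s \<le> r"
  shows "loc_integrable_on (\<lambda>x. u x powr s) \<Omega>"
  unfolding loc_integrable_on_def
proof (intro allI impI)
  fix K :: "'a set"
  assume K: "compact K \<and> K \<subseteq> \<Omega>"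
  then have K_sets: "K \<in> sets lebesgue"
    by (auto intro: lmeasurable_compact fmeasurableD)
  have um: "(\<lambda>x. indicator \<Omega> x *\<^sub>R u x) \<in> borel_measurable lebesgue"
    and ui: "set_integrable lebesgue \<Omega> (\<lambda>x. norm (u x) powr r)"
    using u by (auto simp: Lebesgue_space_def set_borel_measurable_def)
  have "set_integrable lebesgue K (\<lambda>x. norm (u x) powr r)"
    by (rule set_integrable_subset[OF ui K_sets]) (use K in auto)
  then have 1: "integrable lebesgue (\<lambda>x. indicator K x *\<^sub>R (norm (u x) powr r))"
    by (simp add: set_integrable_def)
  have "K \<in> lmeasurable"
    using K by (intro lmeasurable_compact) auto
  then have 2: "integrable lebesgue (\<lambda>x. indicator K x :: real)"
    using K_sets unfolding fmeasurable_def by blast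
  have "integrable lebesgue (\<lambda>x. indicator K x *\<^sub>R u x powr s)"
  proof (rule Bochner_Integration.integrable_bound[OF Bochner_Integration.integrable_add[OF 1 2]])
    \<comment> \<open>Measurability is given only for \<open>u\<close> cut off to
      \<open>\<Omega>\<close>, as its values outside are arbitrary; on \<open>K\<close> the two
      functions agree.\<close>
    have "(\<lambda>x. indicator K x *\<^sub>R (indicator \<Omega> x *\<^sub>R u x) powr s) \<in> borel_measurable lebesgue"
      using um K_sets by measurable
    also have "(\<lambda>x. indicator K x *\<^sub>R (indicator \<Omega> x *\<^sub>R u x) powr s) = (\<lambda>x. indicator K x *\<^sub>R u x powr s)"
      using K by (auto simp: fun_eq_iff indicator_def)
    finally show "(\<lambda>x. indicator K x *\<^sub>R u x powr s) \<in> borel_measurable lebesgue" .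
    show "AE x in lebesgue. norm (indicator K x *\<^sub>R u x powr s)
        \<le> norm (indicator K x *\<^sub>R (norm (u x) powr r) + (indicator K x :: real))"
      using pos
    proof eventually_elim
      fix x
      assume *: "x \<in> \<Omega> \<longrightarrow> u x > 0"
      show "norm (indicator K x *\<^sub>R u x powr s) \<le> norm (indicator K x *\<^sub>R (norm (u x) powr r) + (indicator K x :: real))"
      proof (cases "x \<in> K")
        case True
        with * K have ux: "u x > 0" by auto
        have "u x powr s \<le> u x powr r + 1"
        proof (cases "u x \<ge> 1")
          case True
          then have "u x powr s \<le> u x powr r"
            using s by (intro powr_mono) auto
          then show ?thesis by simp
        next
          case False
          then have "u x powr s \<le> 1"
            using s ux by (intro powr_le1) auto
          then show ?thesis
            by (simp add: add_increasing)
        qed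
        then show ?thesis
          using True ux by simp
      qed simp
    qed
  qed
  then show "set_integrable lebesgue K (\<lambda>x. u x powr s)"
    by (simp add: set_integrable_def)
qed

lemma loc_integrable_div_norm:
  fixes u :: "'a::euclidean_space \<Rightarrow> real"
  assumes "loc_integrable_on u \<Omega>"
  shows "loc_integrable_on (\<lambda>x. u x / (norm x)\<^sup>2) (\<Omega> - {0})"
  unfolding loc_integrable_on_def
proof (intro allI impI)
  fix K :: "'a set"
  assume K: "compact K \<and> K \<subseteq> \<Omega> - {0}"
  then have uK: "integrable lebesgue (\<lambda>x. indicator K x *\<^sub>R u x)" and K_sets: "K \<in> sets lebesgue"
    using assms by (auto simp: loc_integrable_on_def set_integrable_def lmeasurable_compact fmeasurableD)
  have "compact ((\<lambda>x. 1 / (norm x)\<^sup>2) ` K)"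
    using K by (intro compact_continuous_image continuous_intros) auto
  then obtain B where B: "\<And>x. x \<in> K \<Longrightarrow> \<bar>1 / (norm x)\<^sup>2\<bar> \<le> B"
    by (meson bounded_real compact_imp_bounded imageI)
  have "integrable lebesgue (\<lambda>x. (indicator K x *\<^sub>R u x) * (1 / (norm x)\<^sup>2))"
  proof (rule Bochner_Integration.integrable_bound)
    show "integrable lebesgue (\<lambda>x. B *\<^sub>R (indicator K x *\<^sub>R u x))"
      by (rule integrable_scaleR_right[OF uK])
    show "(\<lambda>x. (indicator K x *\<^sub>R u x) * (1 / (norm x)\<^sup>2)) \<in> borel_measurable lebesgue"
      by (intro borel_measurable_times borel_measurable_integrable[OF uK] measurable_completion) measurable
    show "AE x in lebesgue. norm ((indicator K x *\<^sub>R u x) * (1 / (norm x)\<^sup>2)) \<le> norm (B *\<^sub>R (indicator K x *\<^sub>R u x))"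
    proof (intro AE_I2)
      fix x
      show "norm ((indicator K x *\<^sub>R u x) * (1 / (norm x)\<^sup>2)) \<le> norm (B *\<^sub>R (indicator K x *\<^sub>R u x))"
      proof (cases "x \<in> K")
        case True
        then have "\<bar>u x\<bar> * \<bar>1 / (norm x)\<^sup>2\<bar> \<le> \<bar>u x\<bar> * \<bar>B\<bar>"
          using B[of x] by (intro mult_left_mono) auto
        then show ?thesis
          using True by (simp add: abs_mult mult.commute)
      qed simp
    qed
  qed
  then show "set_integrable lebesgue K (\<lambda>x. u x / (norm x)\<^sup>2)"
    by (simp add: set_integrable_def mult.commute)
qed

text \<open>The integrals in the weak formulation can only be added up for test functions supported away
  from the origin, where \<open>u / \<bar>x\<bar>\<^sup>2\<close> is locally integrable without further argument.\<close>

lemma weak_solution_test: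
  assumes sol: "weak_solution \<Omega> \<mu> p q u" and u: "u \<in> Lebesgue_space (q + 1) \<Omega>"
    and pos: "AE x\<in>\<Omega> in lebesgue. u x > 0" and pq: "0 < p" "p < q"
    and \<phi>: "\<phi> \<in> test_functions (\<Omega> - {0})"
  defines "F \<equiv> (\<lambda>x. u x * laplacian \<phi> x + \<mu> * (u x / (norm x)\<^sup>2 * \<phi> x) + (u x powr p - u x powr q) * \<phi> x)"
  shows "set_integrable lebesgue \<Omega> F" "(LINT x:\<Omega>|lebesgue. F x) = 0"
proof -
  have \<phi>': "\<phi> \<in> test_functions \<Omega>"
    using \<phi> by (auto simp: test_functions_def)
  have u_loc: "loc_integrable_on u \<Omega>"
    using sol by (auto simp: weak_solution_def has_weak_gradient_def)
  have \<phi>0: "\<phi> 0 = 0"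
    using \<phi> closure_subset[of "{x. \<phi> x \<noteq> 0}"] by (auto simp: test_functions_def)
  have "set_integrable lebesgue \<Omega> (\<lambda>x. \<Sum>b\<in>Basis. u x * frechet_derivative (\<lambda>y. frechet_derivative \<phi> (at y) b) (at x) b)"
    unfolding set_integrable_def scaleR_sum_right
    by (intro Bochner_Integration.integrable_sum
        set_integrable_loc_times_test[OF u_loc, unfolded set_integrable_def] test_functions_partial \<phi>')
  then have 1: "set_integrable lebesgue \<Omega> (\<lambda>x. u x * laplacian \<phi> x)"
    by (simp add: laplacian_def sum_distrib_left)
  have "set_integrable lebesgue (\<Omega> - {0}) (\<lambda>x. u x / (norm x)\<^sup>2 * \<phi> x)"
    by (rule set_integrable_loc_times_test[OF loc_integrable_div_norm[OF u_loc] \<phi>])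
  moreover have "(\<lambda>x. indicator (\<Omega> - {0}) x *\<^sub>R (u x / (norm x)\<^sup>2 * \<phi> x)) = (\<lambda>x. indicator \<Omega> x *\<^sub>R (u x / (norm x)\<^sup>2 * \<phi> x))"
    using \<phi>0 by (auto simp: fun_eq_iff indicator_def)
  ultimately have 2: "set_integrable lebesgue \<Omega> (\<lambda>x. \<mu> * (u x / (norm x)\<^sup>2 * \<phi> x))"
    by (intro set_integrable_mult_right) (simp add: set_integrable_def)
  have "set_integrable lebesgue \<Omega> (\<lambda>x. u x powr p * \<phi> x)" "set_integrable lebesgue \<Omega> (\<lambda>x. u x powr q * \<phi> x)"
    using pq by (auto intro!: set_integrable_loc_times_test[OF _ \<phi>'] loc_integrable_powr[OF u pos])
  then have 3: "set_integrable lebesgue \<Omega> (\<lambda>x. (u x powr p - u x powr q) * \<phi> x)"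
    unfolding left_diff_distrib by (rule set_integral_diff)
  show "set_integrable lebesgue \<Omega> F"
    unfolding F_def by (intro set_integral_add 1 2 3)
  show "(LINT x:\<Omega>|lebesgue. F x) = 0"
    unfolding F_def
    using weak_solution_laplacian[OF sol \<phi>']
    by (simp only: set_integral_add(2)[OF set_integral_add(1)[OF 1 2] 3] set_integral_add(2)[OF 1 2] set_integral_mult_right)
qed

text \<open>The right-hand side is free of \<open>e\<close>, so the pole can be sharpened as the
  radius of the averaging ball shrinks without losing the bound.\<close>

lemma (in pole_test) nn_integral_one_plus_\<phi>:
  "(\<integral>\<^sup>+x. ennreal (indicator (ball z R) x * (1 + \<phi> x)) \<partial>lebesgue)
    \<le> ennreal ((1 + 2 * 4 powr m) * measure lborel (ball (0::'a) 1) * R ^ DIM('a))"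
proof -
  define V where "V = measure lborel (ball (0::'a) 1)"
  have V: "V \<ge> 0" by (simp add: V_def)
  define g where "g = (\<lambda>x. ennreal (\<tau> x powr (- m)))"
  have [measurable]: "sqdist R e z \<in> borel_measurable borel"
    using smooth_fun_continuous[OF smooth_fun_sqdist] by (rule borel_measurable_continuous_onI)
  have g: "g \<in> borel_measurable lborel"
    unfolding g_def by measurable
  have "(\<integral>\<^sup>+x. ennreal (indicator (ball z R) x * (1 + \<phi> x)) \<partial>lebesgue)
      = (\<integral>\<^sup>+x. ennreal (indicator (ball z R) x * (1 + \<phi> x)) \<partial>lborel)"
    by (rule nn_integral_completion)
  also have "\<dots> \<le> (\<integral>\<^sup>+x. 1 * indicator (ball z R) x + g x * indicator (ball z R) x \<partial>lborel)"
  proof (intro nn_integral_mono)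
    fix x
    show "ennreal (indicator (ball z R) x * (1 + \<phi> x)) \<le> 1 * indicator (ball z R) x + g x * indicator (ball z R) x"
      using pole_le[of m "\<tau> x"] \<phi>_nonneg[of x]
      by (cases "x \<in> ball z R") (simp_all add: g_def \<phi>_def ennreal_plus ennreal_leI add_mono)
  qed
  also have "\<dots> = 1 * emeasure lborel (ball z R) + (\<integral>\<^sup>+x. g x * indicator (ball z R) x \<partial>lborel)"
    by (rule nn_integral_add_cmult_indicator[OF g]) simp_all
  also have "\<dots> \<le> ennreal (V * R ^ DIM('a)) + ennreal (2 * 4 powr m * V * R ^ DIM('a))"
  proof (rule add_mono)
    have "emeasure lborel (ball z R) = ennreal (measure lborel (ball z R))"
      using emeasure_lborel_ball_finite[of z R] by (intro emeasure_eq_ennreal_measure) auto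
    then show "1 * emeasure lborel (ball z R) \<le> ennreal (V * R ^ DIM('a))"
      using content_ball_conv_unit_ball[of R z] R by (simp add: V_def mult.commute)
    show "(\<integral>\<^sup>+x. g x * indicator (ball z R) x \<partial>lborel) \<le> ennreal (2 * 4 powr m * V * R ^ DIM('a))"
      unfolding g_def V_def sqdist_def by (rule nn_integral_pole_ball[OF m e dim R])
  qed
  also have "\<dots> = ennreal ((1 + 2 * 4 powr m) * V * R ^ DIM('a))"
    using V R by (subst ennreal_plus[symmetric]) (auto simp: algebra_simps)
  finally show ?thesis
    by (simp add: V_def)
qed

text \<open>The quantifier order is the content: one \<open>M\<close> serves all centres
  \<open>z\<close>, all scales \<open>R\<close> and all radii \<open>r\<close> up to R / 2, so r can
  later tend to 0 at fixed z.\<close>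

lemma weak_solution_ball_integral_le:
  fixes u :: "'a::euclidean_space \<Rightarrow> real"
  assumes sol: "weak_solution \<Omega> \<mu> p q u" and u: "u \<in> Lebesgue_space (q + 1) \<Omega>"
    and pos: "AE x\<in>\<Omega> in lebesgue. u x > 0" and pq: "0 < p" "p < q" "1 < q" and \<mu>: "\<mu> \<ge> 0"
    and dim: "DIM('a) \<ge> 3" and \<Omega>: "open \<Omega>"
  shows "\<exists>M\<ge>0. \<forall>z R r. 0 < r \<longrightarrow> r \<le> R / 2 \<longrightarrow> R \<le> 1 \<longrightarrow> norm z = 2 * R \<longrightarrow> cball z R \<subseteq> \<Omega> \<longrightarrow>
    set_integrable lebesgue (ball z r) u \<and>
    (LINT x:ball z r|lebesgue. u x) \<le> M * r ^ DIM('a) * R powr (- (2 / (q - 1)))"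
proof -
  define m where "m = (real DIM('a) - 2) / 2"
  have m: "m > 0" "real DIM('a) = 2 * m + 2"
    using dim by (simp_all add: m_def field_simps)
  note m_pos = m(1) and m_dim = m(2)
  obtain C where C: "C \<ge> 0"
    "\<And>e \<tau> t R n. 0 < e \<Longrightarrow> e \<le> \<tau> \<Longrightarrow> \<tau> < 1 \<Longrightarrow> 0 < t \<Longrightarrow> 0 < R \<Longrightarrow> R \<le> 1 \<Longrightarrow> R \<le> n \<Longrightarrow>
      t * pole_error m e \<tau> / R\<^sup>2 + \<mu> * (t / n\<^sup>2 * pole m \<tau>) + (t powr p - t powr q) * pole m \<tau>
      \<le> C * R powr (- (2 * q / (q - 1))) * (1 + pole m \<tau>)"
    using keller_osserman_absorption[OF m(1) pq \<mu>] by blast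
  define c where "c = 4 * m * (m + 1) * flat (1 / 2) * 2 powr (- m - 2)"
  have c: "c > 0"
    using m flat_pos[of "1 / 2"] by (simp add: c_def)
  define A where "A = (1 + 2 * 4 powr m) * measure lborel (ball (0::'a) 1)"
  have A: "A \<ge> 0" by (simp add: A_def)
  have "set_integrable lebesgue (ball z r) u \<and>
      (LINT x:ball z r|lebesgue. u x) \<le> (C * A / c) * r ^ DIM('a) * R powr (- (2 / (q - 1)))"
    if h: "0 < r" "r \<le> R / 2" "R \<le> 1" "norm z = 2 * R" "cball z R \<subseteq> \<Omega>" for z R r
  proof
    have R: "R > 0" using h by linarith
    \<comment> \<open>With this choice |x - z| < r forces \<tau> \<le> 2e, the range of the lower
      bound on the kernel; r \<le> R / 2 supplies e \<le> 1/4.\<close>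
    define e where "e = (r / R)\<^sup>2"
    have e_bounds: "e > 0" "e \<le> 1 / 4"
    proof -
      show "e > 0" using h R by (simp add: e_def)
      have "r / R \<le> 1 / 2" using h R by (simp add: field_simps)
      then have "(r / R)\<^sup>2 \<le> (1 / 2)\<^sup>2"
        using h R by (intro power_mono) auto
      then show "e \<le> 1 / 4" by (simp add: e_def power2_eq_square)
    qed
    interpret pole_test z R e m
      by unfold_locales (use R e_bounds m in auto)
    define D where "D = C * R powr (- (2 * q / (q - 1)))"
    have D: "D \<ge> 0" using C by (simp add: D_def)
    have away: "R \<le> norm x" if "x \<in> cball z R" for x
      using that h norm_triangle_ineq2[of z x] by (simp add: dist_norm)
    define F where "F = (\<lambda>x. u x * laplacian \<phi> x + \<mu> * (u x / (norm x)\<^sup>2 * \<phi> x) + (u x powr p - u x powr q) * \<phi> x)"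
    have "cball z R \<subseteq> \<Omega> - {0}"
      using h away[of 0] R by auto
    note F = weak_solution_test[OF sol u pos pq(1,2) \<phi>_test[OF this], folded F_def]
    have sub: "ball z r \<subseteq> cball z R"
      using h R subset_ball[of r R z] ball_subset_cball[of z R] by auto
    have "set_integrable lebesgue (cball z R) u"
      using sol h by (auto simp: weak_solution_def has_weak_gradient_def loc_integrable_on_def)
    then show ui: "set_integrable lebesgue (ball z r) u"
      by (rule set_integrable_subset) (use sub in auto)
    \<comment> \<open>The integrand \<open>F\<close> contains u times the Laplacian, hence minus the
      kernel times u / R^2. Moving that term to the left turns the absorption estimate into a
      pointwise bound whose only uncontrolled part is \<open>F\<close>, with integral zero over
      \<open>\<Omega>\<close>.\<close>
    have pw: "c * e powr (- m - 1) / R\<^sup>2 * (indicator (ball z r) x * u x)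
        \<le> D * (indicator (ball z R) x * (1 + \<phi> x)) - F x" if x: "u x > 0" for x
    proof -
      have "c * e powr (- m - 1) * indicator (ball z r) x \<le> pole_kernel m e (\<tau> x)"
      proof (cases "x \<in> ball z r")
        case True
        then have "(norm (x - z))\<^sup>2 \<le> r\<^sup>2"
          using h by (intro power_mono) (auto simp: dist_norm norm_minus_commute)
        then have "(norm (x - z))\<^sup>2 / R\<^sup>2 \<le> e"
          by (simp add: e_def power_divide divide_right_mono)
        then have "\<tau> x \<le> 2 * e"
          by (simp add: sqdist_def flip: power2_norm_eq_inner)
        then show ?thesis
          using True pole_kernel_ge[OF m_pos e sqdist_ge _ e_bounds(2), of R z x] by (simp add: c_def)
      qed (use pole_kernel_nonneg[of m e] m e in simp)
      then have "c * e powr (- m - 1) * indicator (ball z r) x * (u x / R\<^sup>2) \<le> pole_kernel m e (\<tau> x) * (u x / R\<^sup>2)"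
        using x by (intro mult_right_mono) auto
      also have "\<dots> \<le> D * (indicator (ball z R) x * (1 + \<phi> x)) - F x"
      proof (cases "\<tau> x < 1")
        case True
        then have xB: "x \<in> ball z R"
          using sqdist_less_1_imp R e by blast
        have "u x * pole_error m e (\<tau> x) / R\<^sup>2 + \<mu> * (u x / (norm x)\<^sup>2 * pole m (\<tau> x))
            + (u x powr p - u x powr q) * pole m (\<tau> x) \<le> D * (1 + pole m (\<tau> x))"
          unfolding D_def using C(2)[OF e sqdist_ge True x R h(3) away] xB by auto
        then show ?thesis
          using xB by (simp add: F_def \<phi>_laplacian \<phi>_def[symmetric] algebra_simps add_divide_distrib diff_divide_distrib)
      next
        case False
        then have "pole m (\<tau> x) = 0" "pole_kernel m e (\<tau> x) = 0" "pole_error m e (\<tau> x) = 0"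
          using pole_support[of m "\<tau> x"] m by auto
        then show ?thesis
          using D by (simp add: F_def \<phi>_laplacian \<phi>_def)
      qed
      finally show ?thesis by (simp add: mult_ac)
    qed
    define J where "J = (\<lambda>x. indicator (ball z R) x * (1 + \<phi> x))"
    have J_nn: "(\<integral>\<^sup>+x. ennreal (J x) \<partial>lebesgue) \<le> ennreal (A * R ^ DIM('a))"
      unfolding J_def A_def by (rule nn_integral_one_plus_\<phi>)
    have J_nonneg: "J x \<ge> 0" for x
      using \<phi>_nonneg[of x] by (simp add: J_def)
    have "\<phi> \<in> borel_measurable borel"
      using smooth_fun_continuous[OF \<phi>_smooth] by (rule borel_measurable_continuous_onI)
    then have "J \<in> borel_measurable lborel"
      unfolding J_def
      by (intro borel_measurable_times borel_measurable_indicator borel_measurable_add borel_measurable_const) simp_all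
    then have "J \<in> borel_measurable lebesgue"
      by (rule measurable_completion)
    then have J: "integrable lebesgue J"
      using J_nn J_nonneg by (intro integrableI_nonneg) (auto intro: order_le_less_trans)
    have J_le: "integral\<^sup>L lebesgue J \<le> A * R ^ DIM('a)"
      using A R J_nn by (intro integral_real_bounded) auto
    have L: "integrable lebesgue (\<lambda>x. indicator (ball z r) x * u x)"
      using ui by (simp add: set_integrable_def)
    have FI: "integrable lebesgue (\<lambda>x. indicator \<Omega> x * F x)" "(\<integral>x. indicator \<Omega> x * F x \<partial>lebesgue) = 0"
      using F by (simp_all add: set_integrable_def set_lebesgue_integral_def)
    have "c * e powr (- m - 1) / R\<^sup>2 * (LINT x:ball z r|lebesgue. u x)
        = (\<integral>x. c * e powr (- m - 1) / R\<^sup>2 * (indicator (ball z r) x * u x) \<partial>lebesgue)"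
      by (simp add: set_lebesgue_integral_def)
    also have "\<dots> \<le> (\<integral>x. D * J x - indicator \<Omega> x * F x \<partial>lebesgue)"
    proof (rule integral_mono_AE)
      show "integrable lebesgue (\<lambda>x. c * e powr (- m - 1) / R\<^sup>2 * (indicator (ball z r) x * u x))"
        by (rule integrable_mult_right[OF L])
      show "integrable lebesgue (\<lambda>x. D * J x - indicator \<Omega> x * F x)"
        by (intro Bochner_Integration.integrable_diff integrable_mult_right J FI)
      show "AE x in lebesgue. c * e powr (- m - 1) / R\<^sup>2 * (indicator (ball z r) x * u x) \<le> D * J x - indicator \<Omega> x * F x"
        using pos
      proof eventually_elim
        fix x
        assume x: "x \<in> \<Omega> \<longrightarrow> u x > 0"
        show "c * e powr (- m - 1) / R\<^sup>2 * (indicator (ball z r) x * u x) \<le> D * J x - indicator \<Omega> x * F x"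
        proof (cases "x \<in> \<Omega>")
          case True
          then show ?thesis
            using pw[of x] x by (simp add: J_def)
        next
          case False
          then have "x \<notin> ball z r"
            using sub h by blast
          then show ?thesis
            using False D J_nonneg by simp
        qed
      qed
    qed
    also have "\<dots> = D * integral\<^sup>L lebesgue J"
      using FI J by simp
    also have "\<dots> \<le> D * (A * R ^ DIM('a))"
      using J_le D by (rule mult_left_mono)
    finally have "(c * e powr (- m - 1) / R\<^sup>2) * (LINT x:ball z r|lebesgue. u x) \<le> D * (A * R ^ DIM('a))" .
    then have "(LINT x:ball z r|lebesgue. u x) \<le> D * (A * R ^ DIM('a)) / (c * e powr (- m - 1) / R\<^sup>2)"
      using c e R by (subst pos_le_divide_eq) (auto simp: mult.commute)
    also have "\<dots> = (C * A / c) * (R ^ DIM('a) / e powr (- m - 1)) * (R powr (- (2 * q / (q - 1))) * R\<^sup>2)"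
      using c e R by (simp add: D_def)
    \<comment> \<open>Because m + 1 = N / 2, the power e^(-m-1) equals (r / R)^(-N).\<close>
    also have "R ^ DIM('a) / e powr (- m - 1) = r ^ DIM('a)"
    proof -
      have "e powr (- m - 1) = (r / R) powr (2 * (- m - 1))"
        unfolding e_def using h R by (simp add: powr_powr flip: powr_numeral)
      also have "\<dots> = (r / R) powr (- real DIM('a))"
        unfolding m_dim by (rule arg_cong) simp
      also have "\<dots> = 1 / (r / R) ^ DIM('a)"
        using h R by (simp add: powr_minus_divide powr_realpow)
      finally show ?thesis
        using h R by (simp add: power_divide)
    qed
    also have "R powr (- (2 * q / (q - 1))) * R\<^sup>2 = R powr (- (2 / (q - 1)))"
    proof -
      have "- (2 * q / (q - 1)) + 2 = - (2 / (q - 1))"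
        using pq by (simp add: field_simps)
      then show ?thesis
        using R powr_add[of R "- (2 * q / (q - 1))" 2] by simp
    qed
    finally show "(LINT x:ball z r|lebesgue. u x) \<le> (C * A / c) * r ^ DIM('a) * R powr (- (2 / (q - 1)))" .
  qed
  moreover have "C * A / c \<ge> 0"
    using C A c by simp
  ultimately show ?thesis
    by blast
qed

section \<open>From averages to the pointwise bound\<close>

theorem theorem1p5:
  fixes \<Omega> :: "'a::euclidean_space set"
    and u :: "'a \<Rightarrow> real"
    and N \<mu> \<mu>bar \<nu> p q twostar :: real
  assumes "N = real DIM('a)" and "N \<ge> 3"
    and "\<mu>bar = ((N - 2) / 2)\<^sup>2"
    and "0 < \<mu>" and "\<mu> < \<mu>bar"
    and "\<nu> = sqrt \<mu>bar - sqrt (\<mu>bar - \<mu>)"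
    and "twostar = 2 * N / (N - 2)"
    and "p \<ge> twostar - 1"
    and "q > max p ((2 + \<nu>) / \<nu>)"
    and "smooth_domain \<Omega>" and "0 \<in> \<Omega>"
    and "u \<in> H1_0 \<Omega> \<inter> Lebesgue_space (q + 1) \<Omega>"
    and "AE x\<in>\<Omega> in lebesgue. u x > 0"
    and "weak_solution \<Omega> \<mu> p q u"
  shows "\<exists>C>0. \<exists>\<rho>>0. ball 0 \<rho> \<subseteq> \<Omega> \<and>
    (AE x\<in>ball 0 \<rho> - {0} in lebesgue. u x \<le> C * norm x powr (- 2 / (q - 1)))"
proof -
  \<comment> \<open>This gives p > 1 and therefore q > 1, as the Keller-Osserman exponent
    requires.\<close>
  have "twostar = 2 + 4 / (N - 2)"
    using assms(2,7) by (simp add: field_simps)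
  then have "twostar > 2"
    using assms(2) by simp
  then have pq: "0 < p" "p < q" "1 < q"
    using assms(8,9) by auto
  define a where "a = 2 / (q - 1)"
  have a: "a > 0" using pq by (simp add: a_def)
  have \<Omega>: "open \<Omega>"
    using assms(10) by (simp add: smooth_domain_def)
  have uL: "u \<in> Lebesgue_space (q + 1) \<Omega>"
    using assms(12) by simp
  have "DIM('a) \<ge> 3" "\<mu> \<ge> 0"
    using assms(1,2,4) by auto
  from weak_solution_ball_integral_le[OF assms(14) uL assms(13) pq this(2,1) \<Omega>]
  obtain M where M: "M \<ge> 0"
    and M_int: "\<And>z R r. 0 < r \<Longrightarrow> r \<le> R / 2 \<Longrightarrow> R \<le> 1 \<Longrightarrow> norm z = 2 * R \<Longrightarrow> cball z R \<subseteq> \<Omega> \<Longrightarrow>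
      set_integrable lebesgue (ball z r) u"
    and M_le: "\<And>z R r. 0 < r \<Longrightarrow> r \<le> R / 2 \<Longrightarrow> R \<le> 1 \<Longrightarrow> norm z = 2 * R \<Longrightarrow> cball z R \<subseteq> \<Omega> \<Longrightarrow>
      (LINT x:ball z r|lebesgue. u x) \<le> M * r ^ DIM('a) * R powr (- a)"
    unfolding a_def by blast
  obtain r0 where r0: "r0 > 0" "ball 0 r0 \<subseteq> \<Omega>"
    using openE[OF \<Omega> assms(11)] .
  \<comment> \<open>For |z| < \<rho> the closed ball of radius |z| / 2 about z lies within distance
    3\<rho>/2 < r0 of the origin, hence in \<open>\<Omega>\<close>.\<close>
  define \<rho> where "\<rho> = min r0 1 / 2"
  have \<rho>: "\<rho> > 0" "2 * \<rho> \<le> r0" "\<rho> \<le> 1"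
    using r0 by (auto simp: \<rho>_def)
  define V where "V = measure lborel (ball (0::'a) 1)"
  have V: "V > 0"
    using content_ball_pos[of 1 "0::'a"] by (simp add: V_def)
  define M' where "M' = 4 powr a * M / V"
  have M': "M' \<ge> 0"
    using M V by (simp add: M'_def)
  \<comment> \<open>The weight |x|^a turns the bound to be proved into a constant one, so the
    differentiation lemma applies to the whole punctured ball at once. On a ball of radius below R /
    2 about z the weight is at most (4R)^a, which cancels R^(-a) and puts 4^a into
    \<open>M'\<close>.\<close>
  define v where "v = (\<lambda>x. ennreal (indicator \<Omega> x * u x * norm x powr a))"
  have "AE x\<in>ball 0 \<rho> - {0} in lebesgue. v x \<le> ennreal M'"
  proof (rule AE_le_of_ball_integrals)
    have "(\<lambda>x. indicator \<Omega> x * u x) \<in> borel_measurable lebesgue"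
      using uL by (simp add: Lebesgue_space_def set_borel_measurable_def)
    moreover have "(\<lambda>x::'a. norm x powr a) \<in> borel_measurable lebesgue"
      by (intro measurable_completion) measurable
    ultimately have "(\<lambda>x. indicator \<Omega> x * u x * norm x powr a) \<in> borel_measurable lebesgue"
      by (rule borel_measurable_times)
    then show "v \<in> borel_measurable lebesgue"
      unfolding v_def by (rule measurable_compose[OF _ measurable_ennreal])
  next
    fix z :: 'a
    assume z: "z \<in> ball 0 \<rho> - {0}"
    define R where "R = norm z / 2"
    have R: "R > 0" "R \<le> 1" "norm z = 2 * R"
      using z \<rho> by (auto simp: R_def)
    have sub: "cball z R \<subseteq> \<Omega>"
    proof
      fix x
      assume "x \<in> cball z R"
      then have "norm x \<le> norm z + R"
        using norm_triangle_ineq2[of x z] by (simp add: dist_norm norm_minus_commute)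
      then have "norm x < r0"
        using z \<rho> by (simp add: R_def)
      then show "x \<in> \<Omega>" using r0 by auto
    qed
    show "\<exists>d>0. \<forall>r. 0 < r \<longrightarrow> r < d \<longrightarrow>
      (\<integral>\<^sup>+y. v y * indicator (ball z r) y \<partial>lebesgue) \<le> ennreal M' * emeasure lebesgue (ball z r)"
    proof (intro exI[of _ "R / 2"] conjI allI impI)
      fix r
      assume r: "0 < r" "r < R / 2"
      have ui: "integrable lebesgue (\<lambda>x. indicator (ball z r) x * u x)"
        using M_int[of r R z] r R sub by (simp add: set_integrable_def)
      have in\<Omega>: "x \<in> \<Omega>" if "x \<in> ball z r" for x
        using that r sub by auto
      have "(\<integral>\<^sup>+y. v y * indicator (ball z r) y \<partial>lebesgue)
          \<le> (\<integral>\<^sup>+y. ennreal ((4 * R) powr a) * ennreal (indicator (ball z r) y * u y) \<partial>lebesgue)"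
      proof (rule nn_integral_mono_AE)
        show "AE y in lebesgue. v y * indicator (ball z r) y \<le> ennreal ((4 * R) powr a) * ennreal (indicator (ball z r) y * u y)"
          using assms(13)
        proof eventually_elim
          fix y
          assume y: "y \<in> \<Omega> \<longrightarrow> u y > 0"
          show "v y * indicator (ball z r) y \<le> ennreal ((4 * R) powr a) * ennreal (indicator (ball z r) y * u y)"
          proof (cases "y \<in> ball z r")
            case True
            have "norm y \<le> norm z + r"
              using norm_triangle_ineq2[of y z] True by (simp add: dist_norm norm_minus_commute)
            then have "norm y \<le> 4 * R"
              using r R by simp
            then have "norm y powr a \<le> (4 * R) powr a"
              using a by (intro powr_mono2) auto
            then have "u y * norm y powr a \<le> (4 * R) powr a * u y"
              using y in\<Omega>[OF True] by (simp add: mult.commute)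
            then show ?thesis
              using True in\<Omega>[OF True] by (simp add: v_def ennreal_leI flip: ennreal_mult')
          qed simp
        qed
      qed
      also have "\<dots> = ennreal ((4 * R) powr a) * (\<integral>\<^sup>+y. ennreal (indicator (ball z r) y * u y) \<partial>lebesgue)"
        using ui by (intro nn_integral_cmult) auto
      also have "(\<integral>\<^sup>+y. ennreal (indicator (ball z r) y * u y) \<partial>lebesgue) = ennreal (\<integral>y. indicator (ball z r) y * u y \<partial>lebesgue)"
      proof (rule nn_integral_eq_integral[OF ui])
        show "AE y in lebesgue. 0 \<le> indicator (ball z r) y * u y"
          using assms(13) by eventually_elim (use in\<Omega> in \<open>auto simp: indicator_def\<close>)
      qed
      also have "\<dots> \<le> ennreal (M * r ^ DIM('a) * R powr (- a))"
        using M_le[of r R z] r R sub by (intro ennreal_leI) (simp add: set_lebesgue_integral_def)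
      also have "ennreal ((4 * R) powr a) * ennreal (M * r ^ DIM('a) * R powr (- a))
          = ennreal (M' * (V * r ^ DIM('a)))"
      proof -
        have "(4 * R) powr a * (M * r ^ DIM('a) * R powr (- a)) = 4 powr a * M * r ^ DIM('a) * (R powr a * R powr (- a))"
          by (simp add: powr_mult)
        also have "R powr a * R powr (- a) = 1"
          using R by (simp flip: powr_add)
        finally have "(4 * R) powr a * (M * r ^ DIM('a) * R powr (- a)) = M' * (V * r ^ DIM('a))"
          using V by (simp add: M'_def)
        then show ?thesis
          using ennreal_mult'[of "(4 * R) powr a" "M * r ^ DIM('a) * R powr (- a)"] by (simp only: powr_ge_zero)
      qed
      also have "\<dots> = ennreal M' * emeasure lebesgue (ball z r)"
      proof -
        have "emeasure lborel (ball z r) = ennreal (measure lborel (ball z r))"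
          using emeasure_lborel_ball_finite[of z r] by (intro emeasure_eq_ennreal_measure) auto
        then show ?thesis
          using content_ball_conv_unit_ball[of r z] r M' V by (simp add: V_def mult.commute ennreal_mult')
      qed
      finally show "(\<integral>\<^sup>+y. v y * indicator (ball z r) y \<partial>lebesgue) \<le> ennreal M' * emeasure lebesgue (ball z r)"
        by (simp add: mult_left_mono)
    qed (use R in simp)
  qed (use M' in auto)
  \<comment> \<open>Adding 1 makes the constant strictly positive even if \<open>M'\<close> is
    0.\<close>
  then have "AE x\<in>ball 0 \<rho> - {0} in lebesgue. u x \<le> (M' + 1) * norm x powr (- 2 / (q - 1))"
  proof eventually_elim
    fix x
    assume *: "x \<in> ball 0 \<rho> - {0} \<longrightarrow> v x \<le> ennreal M'"
    show "x \<in> ball 0 \<rho> - {0} \<longrightarrow> u x \<le> (M' + 1) * norm x powr (- 2 / (q - 1))"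
    proof
      assume x: "x \<in> ball 0 \<rho> - {0}"
      then have "x \<in> \<Omega>"
        using r0 \<rho> by auto
      with * x M' have "u x * norm x powr a \<le> M'"
        by (simp add: v_def ennreal_le_iff)
      then have "u x * norm x powr a \<le> M' + 1" by simp
      moreover have "norm x powr a > 0" using x by simp
      ultimately have "u x \<le> (M' + 1) / norm x powr a"
        by (simp add: pos_le_divide_eq)
      also have "\<dots> = (M' + 1) * norm x powr (- a)"
        by (simp add: powr_minus_divide)
      finally show "u x \<le> (M' + 1) * norm x powr (- 2 / (q - 1))"
        by (simp add: a_def)
    qed
  qed
  moreover have "ball 0 \<rho> \<subseteq> \<Omega>"
    using r0 \<rho> subset_ball[of \<rho> r0 0] by auto
  ultimately show ?thesis
    using \<rho> M' by (intro exI[of _ "M' + 1"] exI[of _ \<rho>]) auto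
qed

end
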